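(* Let $m$ and $d$ be positive integers, and let $U_{m,d}$ be the uniform matroid of rank $d$ on a set of $m+d$ elements. Write its Kazhdan–Lusztig polynomial as $P_{U_{m,d}}(t)=\sum_{i=0}^{\lfloor (d-1)/2\rfloor} c_{m,d}^i t^i$. Then for every $0\le i\le \lfloor (d-1)/2\rfloor$, \[ c_{m,d}^i=\frac{1}{d-i}\binom{d+m}{i}\sum_{h=0}^{m-1}\binom{d-i+h}{h+i+1}\binom{i-1+h}{h}. \]
   Context: Binomial coefficients are $\binom{x}{h}=x(x-1)\cdots(x-h+1)/h!$ for integers $h\ge 0$ (so $\binom{-1}{0}=1$, and $\binom{h-1}{h}=0$ for $h\ge1$). For a loopless matroid $M$ with lattice of flats $L(M)$, characteristic polynomial $\chi_M(t)$ and rank $\operatorname{rk} M$, the Kazhdan–Lusztig polynomial $P_M(t)\in\mathbb{Z}[t]$ is the unique assignment such that: $P_M(t)=1$ if $\operatorname{rk}M=0$; $\deg P_M(t)<\frac12\operatorname{rk}M$ if $\operatorname{rk}M>0$; and $t^{\operatorname{rk}M}P_M(t^{-1})=\sum_{F\in L(M)}\chi_{M_F}(t)P_{M^F}(t)$, where $M_F$ is the restriction of $M$ to the flat $F$ and $M^F$ is the contraction of $M$ by $F$. *)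

theory Defs
  imports Complex_Main "HOL-Library.FuncSet" "HOL-Computational_Algebra.Polynomial"
begin

section \<open>Matroids\<close>

record 'a pre_matroid =
  ground :: "'a set"
  indep :: "'a set set"

locale matroid =
  fixes M :: "'a pre_matroid"
  assumes finite_ground: "finite (ground M)"
    and indep_subset_ground: "I \<in> indep M \<Longrightarrow> I \<subseteq> ground M"
    and indep_empty: "{} \<in> indep M"
    and indep_mono: "I \<in> indep M \<Longrightarrow> J \<subseteq> I \<Longrightarrow> J \<in> indep M"
    and augment: "I \<in> indep M \<Longrightarrow> J \<in> indep M \<Longrightarrow> card I < card J \<Longrightarrow>
      \<exists>x\<in>J - I. insert x I \<in> indep M"

locale loopless_matroid = matroid +
  assumes loopless: "x \<in> ground M \<Longrightarrow> {x} \<in> indep M"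

definition mrank :: "'a pre_matroid \<Rightarrow> 'a set \<Rightarrow> nat" where
  "mrank M X = Max (card ` {I \<in> indep M. I \<subseteq> X})"

abbreviation rk :: "'a pre_matroid \<Rightarrow> nat" where
  "rk M \<equiv> mrank M (ground M)"

definition flats :: "'a pre_matroid \<Rightarrow> 'a set set" where
  "flats M = {F. F \<subseteq> ground M \<and> (\<forall>x\<in>ground M - F. mrank M F < mrank M (insert x F))}"

definition restriction :: "'a pre_matroid \<Rightarrow> 'a set \<Rightarrow> 'a pre_matroid" where
  "restriction M F = \<lparr>ground = F, indep = {I \<in> indep M. I \<subseteq> F}\<rparr>"

definition contraction :: "'a pre_matroid \<Rightarrow> 'a set \<Rightarrow> 'a pre_matroid" where
  "contraction M F = \<lparr>ground = ground M - F,
     indep = {I. I \<subseteq> ground M - F \<and>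
       (\<exists>B\<in>indep M. B \<subseteq> F \<and> card B = mrank M F \<and> I \<union> B \<in> indep M)}\<rparr>"

definition uniform_matroid :: "'a set \<Rightarrow> nat \<Rightarrow> 'a pre_matroid" where
  "uniform_matroid E d = \<lparr>ground = E, indep = {I. I \<subseteq> E \<and> card I \<le> d}\<rparr>"


section \<open>Moebius function and characteristic polynomial\<close>

text \<open>Moebius function of a family \<open>L\<close> of finite sets ordered by inclusion.\<close>

function mobius :: "'a set set \<Rightarrow> 'a set \<Rightarrow> 'a set \<Rightarrow> int" where
  "mobius L A B =
     (if A = B then 1
      else if A \<subset> B \<and> finite B then - (\<Sum>C | C \<in> L \<and> A \<subseteq> C \<and> C \<subset> B. mobius L A C)
      else 0)"
  by auto
termination
  by (relation "measure (\<lambda>(L, A, B). card B)") (auto intro: psubset_card_mono)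

declare mobius.simps [simp del]

text \<open>Only meant for loopless \<open>M\<close>, where the least flat is \<open>{}\<close>.\<close>

definition char_polynomial :: "'a pre_matroid \<Rightarrow> int poly" where
  "char_polynomial M = (\<Sum>F\<in>flats M. monom (mobius (flats M) {} F) (rk M - mrank M F))"


section \<open>Kazhdan--Lusztig polynomials\<close>

text \<open>\<open>recip_poly n p\<close> is \<open>t\<^sup>n p(t\<inverse>)\<close> for \<open>degree p \<le> n\<close>; note that
  \<open>reflect_poly p\<close> is \<open>t\<^sup>k p(t\<inverse>)\<close> with \<open>k = degree p\<close>.\<close>

definition recip_poly :: "nat \<Rightarrow> int poly \<Rightarrow> int poly" where
  "recip_poly n p = monom 1 (n - degree p) * reflect_poly p"

text \<open>Minors stay on the type of the ground set, so the recursion closes on loopless matroids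
  over \<open>'a\<close>. Extensionality pins down the irrelevant values at other arguments.\<close>

definition kl_assignment :: "('a pre_matroid \<Rightarrow> int poly) \<Rightarrow> bool" where
  "kl_assignment P \<longleftrightarrow>
     P \<in> extensional {M. loopless_matroid M} \<and>
     (\<forall>M. loopless_matroid M \<longrightarrow>
       (rk M = 0 \<longrightarrow> P M = 1) \<and>
       (rk M > 0 \<longrightarrow> 2 * degree (P M) < rk M) \<and>
       recip_poly (rk M) (P M) =
         (\<Sum>F\<in>flats M. char_polynomial (restriction M F) * P (contraction M F)))"

definition kl_poly :: "'a pre_matroid \<Rightarrow> int poly" where
  "kl_poly = (THE P. kl_assignment P)"


section \<open>Existence and uniqueness\<close>

subsection \<open>Reciprocal polynomials\<close>

lemma coeff_recip_poly:
  assumes "degree p \<le> n"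
  shows "coeff (recip_poly n p) k = (if k \<le> n then coeff p (n - k) else 0)"
proof -
  have "coeff (recip_poly n p) k =
      (if k < n - degree p then 0 else coeff (reflect_poly p) (k - (n - degree p)))"
    by (simp add: recip_poly_def coeff_monom_mult)
  also have "\<dots> = (if k \<le> n then coeff p (n - k) else 0)"
    using assms by (auto simp: coeff_reflect_poly coeff_eq_0)
  finally show ?thesis .
qed

lemma degree_recip_poly_le:
  assumes "degree p \<le> n" shows "degree (recip_poly n p) \<le> n"
  by (rule degree_le) (auto simp: coeff_recip_poly[OF assms])

lemma recip_poly_mult:
  assumes "degree p \<le> a" "degree q \<le> b"
  shows "recip_poly (a + b) (p * q) = recip_poly a p * recip_poly b q"
proof (cases "p = 0 \<or> q = 0")
  case True
  then show ?thesis by (auto simp: recip_poly_def)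
next
  case False
  then have "degree (p * q) = degree p + degree q" by (simp add: degree_mult_eq)
  moreover have "a + b - (degree p + degree q) = (a - degree p) + (b - degree q)"
    using assms by linarith
  moreover have "monom (1::int) ((a - degree p) + (b - degree q)) =
      monom 1 (a - degree p) * monom 1 (b - degree q)"
    by (simp add: mult_monom)
  ultimately show ?thesis
    by (simp add: recip_poly_def reflect_poly_mult mult_ac)
qed

lemma recip_poly_sum:
  assumes "\<And>x. x \<in> A \<Longrightarrow> degree (f x) \<le> n"
  shows "recip_poly n (\<Sum>x\<in>A. f x) = (\<Sum>x\<in>A. recip_poly n (f x))"
proof (rule poly_eqI)
  fix k
  have "degree (\<Sum>x\<in>A. f x) \<le> n"
    by (cases "finite A") (auto intro: degree_sum_le assms)
  then show "coeff (recip_poly n (\<Sum>x\<in>A. f x)) k = coeff (\<Sum>x\<in>A. recip_poly n (f x)) k"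
    using assms by (simp add: coeff_recip_poly coeff_sum)
qed

lemma recip_poly_monom:
  assumes "k \<le> n" shows "recip_poly n (monom c k) = monom c (n - k)"
proof (rule poly_eqI)
  have "degree (monom c k) \<le> n" using assms degree_monom_le le_trans by blast
  then show "coeff (recip_poly n (monom c k)) j = coeff (monom c (n - k)) j" for j
    using assms by (auto simp: coeff_recip_poly)
qed


subsection \<open>Rank, flats and minors\<close>

context matroid
begin

lemma finite_indep_sets: "finite {I \<in> indep M. I \<subseteq> X}"
  by (rule finite_subset[of _ "Pow (ground M)"]) (auto dest: indep_subset_ground simp: finite_ground)

lemma indep_finite: "I \<in> indep M \<Longrightarrow> finite I"
  using indep_subset_ground finite_ground finite_subset by blast

lemma card_le_mrank: "I \<in> indep M \<Longrightarrow> I \<subseteq> X \<Longrightarrow> card I \<le> mrank M X"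
  unfolding mrank_def using finite_indep_sets by (intro Max_ge) auto

lemma obtain_basis:
  obtains B where "B \<in> indep M" "B \<subseteq> X" "card B = mrank M X"
proof -
  have "{I \<in> indep M. I \<subseteq> X} \<noteq> {}" using indep_empty by blast
  then have "mrank M X \<in> card ` {I \<in> indep M. I \<subseteq> X}"
    unfolding mrank_def using finite_indep_sets by (intro Max_in) auto
  then show thesis using that by auto
qed

lemma mrank_mono: "X \<subseteq> Y \<Longrightarrow> mrank M X \<le> mrank M Y"
  by (metis obtain_basis card_le_mrank subset_trans)

lemma extend_basis:
  assumes "I \<in> indep M" "I \<subseteq> X"
  obtains B where "B \<in> indep M" "I \<subseteq> B" "B \<subseteq> X" "card B = mrank M X"
proof -
  have "\<exists>B\<in>indep M. I \<subseteq> B \<and> B \<subseteq> X \<and> card B = mrank M X"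
    using assms
  proof (induction "mrank M X - card I" arbitrary: I rule: less_induct)
    case less
    show ?case
    proof (cases "card I = mrank M X")
      case True
      then show ?thesis using less.prems by blast
    next
      case False
      then have lt: "card I < mrank M X" using card_le_mrank[OF less.prems] by simp
      obtain J where J: "J \<in> indep M" "J \<subseteq> X" "card J = mrank M X" by (rule obtain_basis)
      obtain x where x: "x \<in> J - I" "insert x I \<in> indep M"
        using augment[OF less.prems(1) J(1)] lt J(3) by auto
      have "card (insert x I) = Suc (card I)"
        using x indep_finite less.prems by simp
      then have "mrank M X - card (insert x I) < mrank M X - card I" using lt by simp
      moreover have "insert x I \<subseteq> X" using x J less.prems by auto
      ultimately obtain B where "B \<in> indep M" "insert x I \<subseteq> B" "B \<subseteq> X" "card B = mrank M X"
        using less.hyps x(2) by blast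
      then show ?thesis by blast
    qed
  qed
  then show thesis using that by blast
qed

lemma indep_iff: "I \<in> indep M \<longleftrightarrow> I \<subseteq> ground M \<and> mrank M I = card I"
proof
  assume I: "I \<in> indep M"
  obtain B where "B \<in> indep M" "B \<subseteq> I" "card B = mrank M I" by (rule obtain_basis)
  then show "I \<subseteq> ground M \<and> mrank M I = card I"
    using I indep_subset_ground card_le_mrank[OF I] card_mono[OF indep_finite[OF I]]
    by (metis le_antisym order_refl)
next
  assume I: "I \<subseteq> ground M \<and> mrank M I = card I"
  obtain B where "B \<in> indep M" "B \<subseteq> I" "card B = mrank M I" by (rule obtain_basis)
  then show "I \<in> indep M"
    using I finite_ground by (metis card_subset_eq finite_subset)
qed

lemma matroid_eqI:
  assumes "matroid N" "ground M = ground N"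
    and "\<And>X. X \<subseteq> ground M \<Longrightarrow> mrank M X = mrank N X"
  shows "M = N"
proof -
  interpret N: matroid N by fact
  have "indep M = indep N"
    using assms indep_iff N.indep_iff by auto
  then show ?thesis using assms(2) by (cases M; cases N) simp
qed

lemma mrank_restriction: "X \<subseteq> F \<Longrightarrow> mrank (restriction M F) X = mrank M X"
  unfolding mrank_def restriction_def
  by (rule arg_cong[where f = "\<lambda>S. Max (card ` S)"]) auto

lemma matroid_restriction:
  assumes "F \<subseteq> ground M" shows "matroid (restriction M F)"
proof
  show "finite (ground (restriction M F))"
    using assms finite_ground finite_subset by (auto simp: restriction_def)
  fix I J assume IJ: "I \<in> indep (restriction M F)" "J \<in> indep (restriction M F)" "card I < card J"
  then show "\<exists>x\<in>J - I. insert x I \<in> indep (restriction M F)"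
    using augment[of I J] by (auto simp: restriction_def)
qed (use assms indep_empty indep_mono in \<open>auto simp: restriction_def\<close>)

lemma contraction_indep:
  assumes B: "B \<in> indep M" "B \<subseteq> F" "card B = mrank M F"
  shows "indep (contraction M F) = {I. I \<subseteq> ground M - F \<and> I \<union> B \<in> indep M}"
proof -
  have "I \<union> B \<in> indep M"
    if I: "I \<subseteq> ground M - F" and C: "C \<in> indep M" "C \<subseteq> F" "card C = mrank M F" "I \<union> C \<in> indep M"
    for I C
  proof -
    have fin: "finite I" "finite B" "finite C"
      using I finite_ground finite_subset indep_finite B C by blast+
    have cIC: "card (I \<union> C) = card I + mrank M F"
      using I C fin by (subst card_Un_disjoint) auto
    obtain A where A: "A \<in> indep M" "B \<subseteq> A" "A \<subseteq> I \<union> F" "card A = mrank M (I \<union> F)"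
      using extend_basis[of B "I \<union> F"] B by blast
    have "card I + mrank M F \<le> card A"
      using cIC A(4) card_le_mrank[OF C(4), of "I \<union> F"] C(2) by auto
    moreover have "A \<inter> F = B"
    proof (rule sym, rule card_subset_eq)
      show "finite (A \<inter> F)" using indep_finite[OF A(1)] by simp
      show "B \<subseteq> A \<inter> F" using A B by blast
      have "card (A \<inter> F) \<le> mrank M F"
        using indep_mono[OF A(1)] by (intro card_le_mrank) auto
      then show "card B = card (A \<inter> F)"
        using B(3) card_mono[OF \<open>finite (A \<inter> F)\<close> \<open>B \<subseteq> A \<inter> F\<close>] by simp
    qed
    moreover from this have "A \<subseteq> I \<union> B" using A(3) by blast
    moreover have "card (I \<union> B) = card I + mrank M F"
      using I B fin by (subst card_Un_disjoint) auto
    ultimately have "A = I \<union> B"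
      using fin by (intro card_seteq) auto
    then show ?thesis using A(1) by simp
  qed
  then show ?thesis using B by (auto simp: contraction_def)
qed

lemma matroid_contraction: "matroid (contraction M F)"
proof -
  obtain B where B: "B \<in> indep M" "B \<subseteq> F" "card B = mrank M F" by (rule obtain_basis)
  note ind = contraction_indep[OF B]
  show ?thesis
  proof
    show "finite (ground (contraction M F))" using finite_ground by (simp add: contraction_def)
    show "I \<subseteq> ground (contraction M F)" if "I \<in> indep (contraction M F)" for I
      using that by (simp add: contraction_def)
    show "{} \<in> indep (contraction M F)" using B by (simp add: ind)
    show "J \<in> indep (contraction M F)" if "I \<in> indep (contraction M F)" "J \<subseteq> I" for I J
      using that indep_mono[of "I \<union> B" "J \<union> B"] by (auto simp: ind)
    fix I J
    assume IJ: "I \<in> indep (contraction M F)" "J \<in> indep (contraction M F)" "card I < card J"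
    have "card (X \<union> B) = card X + card B" if "X \<in> indep (contraction M F)" for X
    proof (rule card_Un_disjoint)
      have X: "X \<subseteq> ground M - F" "X \<union> B \<in> indep M" using that by (auto simp: ind)
      then show "finite X" "finite B" "X \<inter> B = {}" using B indep_finite[OF X(2)] by auto
    qed
    note this[OF IJ(1)] this[OF IJ(2)]
    then obtain x where "x \<in> (J \<union> B) - (I \<union> B)" "insert x (I \<union> B) \<in> indep M"
      using augment[of "I \<union> B" "J \<union> B"] IJ by (auto simp: ind)
    then show "\<exists>x\<in>J - I. insert x I \<in> indep (contraction M F)"
      using IJ by (intro bexI[of _ x]) (auto simp: ind)
  qed
qed

lemma mrank_contraction:
  assumes "X \<subseteq> ground M - F"
  shows "mrank (contraction M F) X + mrank M F = mrank M (X \<union> F)"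
proof -
  interpret C: matroid "contraction M F" by (rule matroid_contraction)
  obtain B where B: "B \<in> indep M" "B \<subseteq> F" "card B = mrank M F" by (rule obtain_basis)
  note ind = contraction_indep[OF B]
  obtain A where A: "A \<in> indep M" "B \<subseteq> A" "A \<subseteq> X \<union> F" "card A = mrank M (X \<union> F)"
    using extend_basis[of B "X \<union> F"] B by blast
  have fA: "finite A" using indep_finite[OF A(1)] .
  have "A \<inter> F = B"
  proof (rule sym, rule card_subset_eq)
    show "finite (A \<inter> F)" using fA by simp
    show "B \<subseteq> A \<inter> F" using A B by blast
    have "card (A \<inter> F) \<le> mrank M F"
      using indep_mono[OF A(1)] by (intro card_le_mrank) auto
    then show "card B = card (A \<inter> F)"
      using B(3) card_mono[OF \<open>finite (A \<inter> F)\<close> \<open>B \<subseteq> A \<inter> F\<close>] by simp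
  qed
  then have "A - B \<subseteq> X" using A by blast
  moreover have "A - B \<in> indep (contraction M F)"
    using \<open>A - B \<subseteq> X\<close> A assms by (auto simp: ind Un_absorb2)
  ultimately have "card (A - B) \<le> mrank (contraction M F) X" by (rule C.card_le_mrank[rotated])
  moreover have "card (A - B) + mrank M F = mrank M (X \<union> F)"
    using A B fA by (metis card_Diff_subset card_mono finite_subset le_add_diff_inverse2)
  moreover obtain Z where Z: "Z \<in> indep (contraction M F)" "Z \<subseteq> X" "card Z = mrank (contraction M F) X"
    by (rule C.obtain_basis)
  moreover have "card (Z \<union> B) = card Z + card B"
  proof (rule card_Un_disjoint)
    have "Z \<subseteq> ground M - F" "Z \<union> B \<in> indep M" using Z(1) by (auto simp: ind)
    then show "finite Z" "finite B" "Z \<inter> B = {}" using B indep_finite[of "Z \<union> B"] by auto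
  qed
  moreover have "card (Z \<union> B) \<le> mrank M (X \<union> F)"
    using Z B by (intro card_le_mrank) (auto simp: ind)
  ultimately show ?thesis using B(3) by linarith
qed

lemma ground_contraction [simp]: "ground (contraction M F) = ground M - F"
  by (simp add: contraction_def)

lemma ground_restriction [simp]: "ground (restriction M F) = F"
  by (simp add: restriction_def)

lemma flats_subset: "F \<in> flats M \<Longrightarrow> F \<subseteq> ground M"
  by (simp add: flats_def)

lemma finite_flats: "finite (flats M)"
  by (rule finite_subset[of _ "Pow (ground M)"]) (auto simp: finite_ground flats_def)

lemma flat_finite: "F \<in> flats M \<Longrightarrow> finite F"
  using flats_subset finite_ground finite_subset by blast

lemma ground_in_flats: "ground M \<in> flats M"
  by (simp add: flats_def)

lemma mem_flats_contraction:
  assumes "F \<subseteq> ground M" "G \<subseteq> ground M - F"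
  shows "G \<in> flats (contraction M F) \<longleftrightarrow> G \<union> F \<in> flats M"
proof -
  have "mrank (contraction M F) G < mrank (contraction M F) (insert x G) \<longleftrightarrow>
      mrank M (G \<union> F) < mrank M (insert x (G \<union> F))" if "x \<in> ground M - (G \<union> F)" for x
    using mrank_contraction[of G F] mrank_contraction[of "insert x G" F] assms that
    by auto
  then show ?thesis
    using assms by (auto simp: flats_def)
qed

lemma flats_contraction:
  assumes "F \<subseteq> ground M"
  shows "flats (contraction M F) = (\<lambda>G. G - F) ` {G \<in> flats M. F \<subseteq> G}"
proof (intro equalityI subsetI)
  fix G assume G: "G \<in> flats (contraction M F)"
  then have sub: "G \<subseteq> ground M - F" by (simp add: flats_def)
  then have "G \<union> F \<in> flats M" "G = (G \<union> F) - F"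
    using mem_flats_contraction[OF assms sub] G by auto
  then show "G \<in> (\<lambda>G. G - F) ` {G \<in> flats M. F \<subseteq> G}" by blast
next
  fix G assume "G \<in> (\<lambda>G. G - F) ` {G \<in> flats M. F \<subseteq> G}"
  then obtain H where H: "H \<in> flats M" "F \<subseteq> H" "G = H - F" by blast
  then have "G \<subseteq> ground M - F" "G \<union> F = H" using flats_subset by auto
  then show "G \<in> flats (contraction M F)" using mem_flats_contraction[OF assms] H by simp
qed

lemma flats_restriction:
  assumes F: "F \<in> flats M"
  shows "flats (restriction M F) = {G \<in> flats M. G \<subseteq> F}"
proof (intro equalityI subsetI)
  fix G assume "G \<in> {G \<in> flats M. G \<subseteq> F}"
  then show "G \<in> flats (restriction M F)"
    using flats_subset[OF F] by (auto simp: flats_def mrank_restriction)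
next
  fix G assume G: "G \<in> flats (restriction M F)"
  then have GF: "G \<subseteq> F" by (simp add: flats_def)
  have "mrank M G < mrank M (insert x G)" if x: "x \<in> ground M - G" for x
  proof (cases "x \<in> F")
    case True
    then show ?thesis using G x GF by (auto simp: flats_def mrank_restriction)
  next
    case False
    obtain B where B: "B \<in> indep M" "B \<subseteq> G" "card B = mrank M G" by (rule obtain_basis)
    obtain C where C: "C \<in> indep M" "B \<subseteq> C" "C \<subseteq> F" "card C = mrank M F"
      using extend_basis[of B F] B GF by blast
    obtain D where D: "D \<in> indep M" "C \<subseteq> D" "D \<subseteq> insert x F" "card D = mrank M (insert x F)"
      using extend_basis[of C "insert x F"] C by blast
    have "mrank M F < mrank M (insert x F)" using F x False by (auto simp: flats_def)
    then have "\<not> D \<subseteq> F" using card_le_mrank[OF D(1)] D(4) by (metis not_le)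
    then have "x \<in> D" using D(3) by blast
    then have "insert x B \<in> indep M" using indep_mono[OF D(1)] C D by blast
    then have "card (insert x B) \<le> mrank M (insert x G)" using B by (intro card_le_mrank) auto
    moreover have "card (insert x B) = Suc (card B)"
      using B x indep_finite by (subst card_insert_disjoint) auto
    ultimately show ?thesis using B by simp
  qed
  then show "G \<in> {G \<in> flats M. G \<subseteq> F}"
    using GF flats_subset[OF F] by (auto simp: flats_def)
qed

lemma contraction_contraction:
  assumes "F \<subseteq> G" "G \<subseteq> ground M"
  shows "contraction (contraction M F) (G - F) = contraction M G"
proof -
  interpret C: matroid "contraction M F" by (rule matroid_contraction)
  interpret CC: matroid "contraction (contraction M F) (G - F)" by (rule C.matroid_contraction)
  show ?thesis
  proof (rule CC.matroid_eqI)
    show "matroid (contraction M G)" by (rule matroid_contraction)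
    show "ground (contraction (contraction M F) (G - F)) = ground (contraction M G)"
      using assms by auto
    fix X assume "X \<subseteq> ground (contraction (contraction M F) (G - F))"
    then have X: "X \<subseteq> ground M - F - (G - F)" "X \<subseteq> ground M - G" using assms by auto
    have eq: "X \<union> (G - F) \<union> F = X \<union> G" "G - F \<union> F = G" using assms by auto
    have "mrank (contraction (contraction M F) (G - F)) X + mrank (contraction M F) (G - F) =
        mrank (contraction M F) (X \<union> (G - F))"
      using C.mrank_contraction[of X "G - F"] X by simp
    moreover have "mrank (contraction M F) (X \<union> (G - F)) + mrank M F = mrank M (X \<union> G)"
      using mrank_contraction[of "X \<union> (G - F)" F] X assms eq by auto
    moreover have "mrank (contraction M F) (G - F) + mrank M F = mrank M G"
      using mrank_contraction[of "G - F" F] assms eq by auto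
    moreover have "mrank (contraction M G) X + mrank M G = mrank M (X \<union> G)"
      using mrank_contraction[of X G] X by auto
    ultimately show "mrank (contraction (contraction M F) (G - F)) X = mrank (contraction M G) X"
      by linarith
  qed
qed

lemma restriction_contraction:
  assumes "F \<subseteq> G" "G \<subseteq> ground M"
  shows "restriction (contraction M F) (G - F) = contraction (restriction M G) F"
proof -
  interpret C: matroid "contraction M F" by (rule matroid_contraction)
  interpret R: matroid "restriction M G" by (rule matroid_restriction) fact
  interpret RC: matroid "restriction (contraction M F) (G - F)"
    by (rule C.matroid_restriction) (use assms in auto)
  show ?thesis
  proof (rule RC.matroid_eqI)
    show "matroid (contraction (restriction M G) F)" by (rule R.matroid_contraction)
    show "ground (restriction (contraction M F) (G - F)) = ground (contraction (restriction M G) F)"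
      by simp
    fix X assume "X \<subseteq> ground (restriction (contraction M F) (G - F))"
    then have X: "X \<subseteq> G - F" "X \<subseteq> ground M - F" "X \<union> F \<subseteq> G" using assms by auto
    show "mrank (restriction (contraction M F) (G - F)) X = mrank (contraction (restriction M G) F) X"
      using mrank_contraction[of X F] R.mrank_contraction[of X F] X assms
      by (simp add: C.mrank_restriction mrank_restriction)
  qed
qed

lemma restriction_ground: "restriction M (ground M) = M"
  using indep_subset_ground by (cases M) (auto simp: restriction_def)

lemma contraction_empty: "contraction M {} = M"
proof -
  have "mrank M {} = 0"
    using obtain_basis[of "{}"] by (metis card.empty subset_empty)
  then show ?thesis
    using indep_empty indep_subset_ground
    by (cases M) (auto simp: contraction_def)
qed

end

context loopless_matroid
begin

lemma mrank_empty: "mrank M {} = 0"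
  using obtain_basis[of "{}"] by (metis card.empty subset_empty)

lemma empty_in_flats: "{} \<in> flats M"
proof -
  have "0 < mrank M {x}" if "x \<in> ground M" for x
    using card_le_mrank[OF loopless[OF that]] by fastforce
  then show ?thesis by (simp add: flats_def mrank_empty)
qed

lemma rk_eq_0_iff: "rk M = 0 \<longleftrightarrow> ground M = {}"
proof
  assume "rk M = 0"
  then show "ground M = {}"
    using card_le_mrank[OF loopless] by fastforce
qed (simp add: mrank_empty)

lemma mrank_pos:
  assumes "F \<subseteq> ground M" "F \<noteq> {}" shows "0 < mrank M F"
proof -
  obtain x where "x \<in> F" using assms by blast
  then have "card {x} \<le> mrank M F" using assms by (intro card_le_mrank loopless) auto
  then show ?thesis by simp
qed

lemma loopless_restriction:
  assumes "F \<subseteq> ground M" shows "loopless_matroid (restriction M F)"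
proof -
  interpret R: matroid "restriction M F" by (rule matroid_restriction) fact
  show ?thesis
    by unfold_locales (use assms loopless in \<open>auto simp: restriction_def\<close>)
qed

lemma loopless_contraction:
  assumes F: "F \<in> flats M" shows "loopless_matroid (contraction M F)"
proof -
  interpret C: matroid "contraction M F" by (rule matroid_contraction)
  show ?thesis
  proof
    fix x assume "x \<in> ground (contraction M F)"
    then have x: "x \<in> ground M - F" by simp
    have "mrank M F < mrank M ({x} \<union> F)" using F x by (auto simp: flats_def)
    then have "0 < mrank (contraction M F) {x}"
      using mrank_contraction[of "{x}" F] x by auto
    moreover obtain B where B: "B \<in> indep (contraction M F)" "B \<subseteq> {x}"
        "card B = mrank (contraction M F) {x}"
      by (rule C.obtain_basis)
    ultimately have "B = {x}" by (auto simp: subset_singleton_iff)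
    then show "{x} \<in> indep (contraction M F)" using B by simp
  qed
qed

end


subsection \<open>The Moebius function\<close>

lemma mobius_refl [simp]: "mobius L A A = 1"
  by (subst mobius.simps) simp

lemma sum_mobius:
  assumes "finite L" "A \<in> L" "B \<in> L" "A \<subseteq> B" "finite B"
  shows "(\<Sum>C | C \<in> L \<and> A \<subseteq> C \<and> C \<subseteq> B. mobius L A C) = (if A = B then 1 else 0)"
proof (cases "A = B")
  case True
  then have "{C. C \<in> L \<and> A \<subseteq> C \<and> C \<subseteq> B} = {A}" using assms by auto
  then show ?thesis using True by simp
next
  case False
  have "{C. C \<in> L \<and> A \<subseteq> C \<and> C \<subseteq> B} = insert B {C. C \<in> L \<and> A \<subseteq> C \<and> C \<subset> B}"
    using assms by auto
  then have "(\<Sum>C | C \<in> L \<and> A \<subseteq> C \<and> C \<subseteq> B. mobius L A C) =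
      mobius L A B + (\<Sum>C | C \<in> L \<and> A \<subseteq> C \<and> C \<subset> B. mobius L A C)"
    using assms by simp
  moreover have "mobius L A B = - (\<Sum>C | C \<in> L \<and> A \<subseteq> C \<and> C \<subset> B. mobius L A C)"
    using False assms by (subst mobius.simps) auto
  ultimately show ?thesis using False by simp
qed

lemma sum_mobius_left:
  assumes L: "finite L" and A: "A \<in> L" and "B \<in> L" "A \<subseteq> B" "finite B"
  shows "(\<Sum>C | C \<in> L \<and> A \<subseteq> C \<and> C \<subseteq> B. mobius L C B) = (if A = B then 1 else 0)"
  using assms(3-)
proof (induction "card B" arbitrary: B rule: less_induct)
  case less
  define I where "I X Y = {C. C \<in> L \<and> X \<subseteq> C \<and> C \<subseteq> Y}" for X Y
  have fin: "finite (I X Y)" for X Y using L by (simp add: I_def)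
  define s where "s K = (\<Sum>C\<in>I A K. mobius L C K)" for K
  have "(\<Sum>K\<in>I A B. s K) = (\<Sum>K\<in>I A B. \<Sum>C\<in>I A B. if C \<subseteq> K then mobius L C K else 0)"
    unfolding s_def
    by (intro sum.cong refl sum.mono_neutral_cong_left fin) (auto simp: I_def)
  also have "\<dots> = (\<Sum>C\<in>I A B. \<Sum>K\<in>I A B. if C \<subseteq> K then mobius L C K else 0)"
    by (rule sum.swap)
  also have "\<dots> = (\<Sum>C\<in>I A B. \<Sum>K\<in>I C B. mobius L C K)"
    by (intro sum.cong refl sum.mono_neutral_cong_right fin) (auto simp: I_def)
  also have "\<dots> = (\<Sum>C\<in>I A B. if C = B then 1 else 0)"
    using less.prems L unfolding I_def by (intro sum.cong refl sum_mobius) auto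
  also have "\<dots> = 1"
    using less.prems by (subst sum.delta[OF fin]) (auto simp: I_def)
  finally have total: "(\<Sum>K\<in>I A B. s K) = 1" .
  show ?case
  proof (cases "A = B")
    case True
    then have "{C. C \<in> L \<and> A \<subseteq> C \<and> C \<subseteq> B} = {B}" using less.prems by auto
    then show ?thesis using True by simp
  next
    case False
    have "s K = (if K = A then 1 else 0)" if "K \<in> I A B - {B}" for K
    proof -
      have "K \<in> L" "A \<subseteq> K" "K \<subset> B" using that by (auto simp: I_def)
      then show ?thesis
        using less.hyps[of K] less.prems psubset_card_mono[of B K] finite_subset[of K B]
        by (auto simp: s_def I_def)
    qed
    then have "(\<Sum>K\<in>I A B - {B}. s K) = (\<Sum>K\<in>I A B - {B}. if K = A then 1 else 0)"
      by (rule sum.cong[OF refl])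
    also have "\<dots> = 1"
      using fin False less.prems A by (subst sum.delta) (auto simp: I_def)
    finally have "(\<Sum>K\<in>I A B - {B}. s K) = 1" .
    moreover have "(\<Sum>K\<in>I A B. s K) = s B + (\<Sum>K\<in>I A B - {B}. s K)"
      using less.prems by (intro sum.remove fin) (auto simp: I_def)
    ultimately have "s B = 0" using total by simp
    then show ?thesis using False by (simp add: s_def I_def)
  qed
qed

lemma mobius_shift:
  assumes "F \<subseteq> H" "H \<subseteq> G" "finite G"
  shows "mobius ((\<lambda>H. H - F) ` {H \<in> L. F \<subseteq> H \<and> H \<subseteq> G}) {} (H - F) = mobius L F H"
  using assms
proof (induction "card H" arbitrary: H rule: less_induct)
  case less
  let ?L = "(\<lambda>H. H - F) ` {H \<in> L. F \<subseteq> H \<and> H \<subseteq> G}"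
  have fH: "finite H" using less.prems finite_subset by blast
  show ?case
  proof (cases "F = H")
    case False
    then have FH: "F \<subset> H" using less.prems by blast
    have eq: "{C. C \<in> ?L \<and> {} \<subseteq> C \<and> C \<subset> H - F} = (\<lambda>H. H - F) ` {C. C \<in> L \<and> F \<subseteq> C \<and> C \<subset> H}"
    proof (intro equalityI subsetI)
      fix C assume "C \<in> {C. C \<in> ?L \<and> {} \<subseteq> C \<and> C \<subset> H - F}"
      then obtain D where D: "D \<in> L" "F \<subseteq> D" "C = D - F" "D - F \<subset> H - F" by blast
      then have "D \<subset> H" using less.prems by blast
      then show "C \<in> (\<lambda>H. H - F) ` {C. C \<in> L \<and> F \<subseteq> C \<and> C \<subset> H}" using D by blast
    next
      fix C assume "C \<in> (\<lambda>H. H - F) ` {C. C \<in> L \<and> F \<subseteq> C \<and> C \<subset> H}"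
      then obtain D where D: "D \<in> L" "F \<subseteq> D" "C = D - F" "D \<subset> H" by blast
      then have "D \<subseteq> G" "D - F \<subset> H - F" using less.prems by blast+
      then show "C \<in> {C. C \<in> ?L \<and> {} \<subseteq> C \<and> C \<subset> H - F}" using D by blast
    qed
    have inj: "inj_on (\<lambda>H. H - F) {C. C \<in> L \<and> F \<subseteq> C \<and> C \<subset> H}"
      by (rule inj_onI) blast
    have "mobius ?L {} (H - F) = - (\<Sum>C | C \<in> ?L \<and> {} \<subseteq> C \<and> C \<subset> H - F. mobius ?L {} C)"
      using FH fH by (subst mobius.simps) auto
    also have "\<dots> = - (\<Sum>C | C \<in> L \<and> F \<subseteq> C \<and> C \<subset> H. mobius ?L {} (C - F))"
      unfolding eq by (simp add: sum.reindex[OF inj])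
    also have "\<dots> = - (\<Sum>C | C \<in> L \<and> F \<subseteq> C \<and> C \<subset> H. mobius L F C)"
    proof -
      have "mobius ?L {} (C - F) = mobius L F C" if "C \<in> L \<and> F \<subseteq> C \<and> C \<subset> H" for C
        using less.hyps[of C] less.prems psubset_card_mono[OF fH, of C] that by blast
      then show ?thesis by simp
    qed
    also have "\<dots> = mobius L F H"
      using FH fH by (simp add: mobius.simps[of L F H])
    finally show ?thesis .
  qed simp
qed


subsection \<open>The Kazhdan--Lusztig recursion\<close>

context loopless_matroid
begin

lemma char_polynomial_minor:
  assumes F: "F \<in> flats M" and G: "G \<in> flats M" and FG: "F \<subseteq> G"
  shows "char_polynomial (contraction (restriction M G) F) =
    (\<Sum>H | H \<in> flats M \<and> F \<subseteq> H \<and> H \<subseteq> G. monom (mobius (flats M) F H) (mrank M G - mrank M H))"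
proof -
  let ?N = "contraction (restriction M G) F"
  let ?I = "{H \<in> flats M. F \<subseteq> H \<and> H \<subseteq> G}"
  interpret R: matroid "restriction M G" by (rule matroid_restriction[OF flats_subset[OF G]])
  have flN: "flats ?N = (\<lambda>H. H - F) ` ?I"
    using R.flats_contraction[of F] FG flats_restriction[OF G] by (simp add: conj_commute conj_left_commute)
  have inj: "inj_on (\<lambda>H. H - F) ?I" by (rule inj_onI) blast
  have rank: "mrank ?N (H - F) + mrank M F = mrank M H" if "F \<subseteq> H" "H \<subseteq> G" for H
  proof -
    have "H - F \<union> F = H" using that by blast
    then show ?thesis
      using R.mrank_contraction[of "H - F" F] that FG by (auto simp: mrank_restriction)
  qed
  have "char_polynomial ?N =
      (\<Sum>H\<in>?I. monom (mobius (flats ?N) {} (H - F)) (mrank ?N (G - F) - mrank ?N (H - F)))"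
    unfolding char_polynomial_def by (subst (2) flN) (simp add: sum.reindex[OF inj])
  also have "\<dots> = (\<Sum>H\<in>?I. monom (mobius (flats M) F H) (mrank M G - mrank M H))"
  proof (rule sum.cong[OF refl])
    fix H assume H: "H \<in> ?I"
    have "mobius (flats ?N) {} (H - F) = mobius (flats M) F H"
      unfolding flN using H flat_finite[OF G] by (intro mobius_shift) auto
    moreover have "mrank ?N (G - F) - mrank ?N (H - F) = mrank M G - mrank M H"
      using rank[of H] rank[of G] H FG by auto
    ultimately show "monom (mobius (flats ?N) {} (H - F)) (mrank ?N (G - F) - mrank ?N (H - F)) =
        monom (mobius (flats M) F H) (mrank M G - mrank M H)" by simp
  qed
  finally show ?thesis by simp
qed

lemma char_polynomial_restriction:
  assumes G: "G \<in> flats M"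
  shows "char_polynomial (restriction M G) =
    (\<Sum>H | H \<in> flats M \<and> H \<subseteq> G. monom (mobius (flats M) {} H) (mrank M G - mrank M H))"
proof -
  interpret R: matroid "restriction M G" by (rule matroid_restriction[OF flats_subset[OF G]])
  show ?thesis
    using char_polynomial_minor[OF empty_in_flats G] by (simp add: R.contraction_empty)
qed

lemma degree_char_polynomial_restriction:
  assumes G: "G \<in> flats M"
  shows "degree (char_polynomial (restriction M G)) \<le> mrank M G"
  unfolding char_polynomial_restriction[OF G]
  using finite_flats
  by (intro degree_sum_le) (auto intro: order_trans[OF degree_monom_le])

lemma recip_char_polynomial_restriction:
  assumes G: "G \<in> flats M"
  shows "recip_poly (mrank M G) (char_polynomial (restriction M G)) =
    (\<Sum>H | H \<in> flats M \<and> H \<subseteq> G. monom (mobius (flats M) {} H) (mrank M H))"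
proof -
  have "recip_poly (mrank M G) (monom (mobius (flats M) {} H) (mrank M G - mrank M H)) =
      monom (mobius (flats M) {} H) (mrank M H)" if "H \<subseteq> G" for H
    using mrank_mono[OF that] by (simp add: recip_poly_monom)
  then show ?thesis
    unfolding char_polynomial_restriction[OF G]
    by (subst recip_poly_sum) (auto intro: order_trans[OF degree_monom_le])
qed

lemma char_polynomial_kernel:
  assumes G: "G \<in> flats M"
  shows "(\<Sum>F | F \<in> flats M \<and> F \<subseteq> G. recip_poly (mrank M F) (char_polynomial (restriction M F)) *
      char_polynomial (contraction (restriction M G) F)) = (if G = {} then 1 else 0)"
proof -
  let ?\<mu> = "mobius (flats M)"
  define I where "I = {F. F \<in> flats M \<and> F \<subseteq> G}"
  have fI: "finite I" using finite_flats by (simp add: I_def)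
  define e where "e H K = monom (?\<mu> {} H) (mrank M H + (mrank M G - mrank M K))" for H K
  have "(\<Sum>F\<in>I. recip_poly (mrank M F) (char_polynomial (restriction M F)) *
      char_polynomial (contraction (restriction M G) F)) =
      (\<Sum>F\<in>I. \<Sum>H\<in>I. \<Sum>K\<in>I. if H \<subseteq> F \<and> F \<subseteq> K then smult (?\<mu> F K) (e H K) else 0)"
  proof (rule sum.cong[OF refl])
    fix F assume "F \<in> I"
    then have F: "F \<in> flats M" "F \<subseteq> G" by (auto simp: I_def)
    have "recip_poly (mrank M F) (char_polynomial (restriction M F)) =
        (\<Sum>H\<in>I. if H \<subseteq> F then monom (?\<mu> {} H) (mrank M H) else 0)"
      unfolding recip_char_polynomial_restriction[OF F(1)]
      using F fI by (intro sum.mono_neutral_cong_left) (auto simp: I_def)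
    moreover have "char_polynomial (contraction (restriction M G) F) =
        (\<Sum>K\<in>I. if F \<subseteq> K then monom (?\<mu> F K) (mrank M G - mrank M K) else 0)"
      unfolding char_polynomial_minor[OF F(1) G F(2)]
      using F fI by (intro sum.mono_neutral_cong_left) (auto simp: I_def)
    ultimately show "recip_poly (mrank M F) (char_polynomial (restriction M F)) *
        char_polynomial (contraction (restriction M G) F) =
        (\<Sum>H\<in>I. \<Sum>K\<in>I. if H \<subseteq> F \<and> F \<subseteq> K then smult (?\<mu> F K) (e H K) else 0)"
      by (auto simp: sum_product e_def mult_monom smult_monom mult.commute intro!: sum.cong)
  qed
  also have "\<dots> = (\<Sum>H\<in>I. \<Sum>F\<in>I. \<Sum>K\<in>I. if H \<subseteq> F \<and> F \<subseteq> K then smult (?\<mu> F K) (e H K) else 0)"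
    by (rule sum.swap)
  also have "\<dots> = (\<Sum>H\<in>I. \<Sum>K\<in>I. \<Sum>F\<in>I. if H \<subseteq> F \<and> F \<subseteq> K then smult (?\<mu> F K) (e H K) else 0)"
    by (intro sum.cong refl sum.swap)
  also have "\<dots> = (\<Sum>H\<in>I. \<Sum>K\<in>I. if K = H then e H K else 0)"
  proof (intro sum.cong refl)
    fix H K assume HK: "H \<in> I" "K \<in> I"
    then have HKL: "H \<in> flats M" "K \<in> flats M" "K \<subseteq> G" by (auto simp: I_def)
    have "(\<Sum>F\<in>I. if H \<subseteq> F \<and> F \<subseteq> K then smult (?\<mu> F K) (e H K) else 0) =
        (\<Sum>F | F \<in> flats M \<and> H \<subseteq> F \<and> F \<subseteq> K. smult (?\<mu> F K) (e H K))"
      using HKL fI by (intro sum.mono_neutral_cong_right) (auto simp: I_def)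
    also have "\<dots> = smult (\<Sum>F | F \<in> flats M \<and> H \<subseteq> F \<and> F \<subseteq> K. ?\<mu> F K) (e H K)"
      by (simp add: smult_sum)
    also have "\<dots> = (if K = H then e H K else 0)"
    proof (cases "H \<subseteq> K")
      case True
      then show ?thesis
        using sum_mobius_left[OF finite_flats HKL(1,2) True flat_finite[OF HKL(2)]] by auto
    next
      case False
      then have "{F. F \<in> flats M \<and> H \<subseteq> F \<and> F \<subseteq> K} = {}" by auto
      then have "(\<Sum>F | F \<in> flats M \<and> H \<subseteq> F \<and> F \<subseteq> K. ?\<mu> F K) = 0"
        by (metis sum.empty)
      then show ?thesis using False by auto
    qed
    finally show "(\<Sum>F\<in>I. if H \<subseteq> F \<and> F \<subseteq> K then smult (?\<mu> F K) (e H K) else 0) =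
        (if K = H then e H K else 0)" .
  qed
  also have "\<dots> = (\<Sum>H\<in>I. e H H)"
    using fI by (intro sum.cong refl) (simp add: sum.delta)
  also have "\<dots> = (\<Sum>H\<in>I. monom (?\<mu> {} H) (mrank M G))"
    by (intro sum.cong refl) (auto simp: e_def I_def mrank_mono)
  also have "\<dots> = monom (\<Sum>H\<in>I. ?\<mu> {} H) (mrank M G)"
    by (rule poly_eqI) (simp add: coeff_sum)
  also have "\<dots> = (if G = {} then 1 else 0)"
    using sum_mobius[OF finite_flats empty_in_flats G _ flat_finite[OF G]]
    by (auto simp: I_def mrank_empty)
  finally show ?thesis by (simp add: I_def)
qed

lemma kl_equation_contraction:
  assumes F: "F \<in> flats M"
  shows "(\<Sum>G\<in>flats (contraction M F). char_polynomial (restriction (contraction M F) G) *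
        P (contraction (contraction M F) G)) =
    (\<Sum>G | G \<in> flats M \<and> F \<subseteq> G. char_polynomial (contraction (restriction M G) F) * P (contraction M G))"
proof -
  have inj: "inj_on (\<lambda>H. H - F) {G \<in> flats M. F \<subseteq> G}" by (rule inj_onI) blast
  show ?thesis
    unfolding flats_contraction[OF flats_subset[OF F]]
    by (simp add: sum.reindex[OF inj] restriction_contraction contraction_contraction flats_subset)
qed

lemma rk_contraction: "F \<in> flats M \<Longrightarrow> rk (contraction M F) + mrank M F = rk M"
  using mrank_contraction[of "ground M - F" F] flats_subset[of F]
  by (simp add: Un_absorb2)

definition kl_rest :: "('a pre_matroid \<Rightarrow> int poly) \<Rightarrow> int poly" where
  "kl_rest P = (\<Sum>F\<in>flats M - {{}}. char_polynomial (restriction M F) * P (contraction M F))"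

lemma char_polynomial_restriction_empty: "char_polynomial (restriction M {}) = 1"
proof -
  have "{H. H \<in> flats M \<and> H \<subseteq> {}} = {{}}" using empty_in_flats by auto
  then show ?thesis
    using char_polynomial_restriction[OF empty_in_flats] by (simp add: mrank_empty)
qed

lemma kl_sum_eq:
  "(\<Sum>F\<in>flats M. char_polynomial (restriction M F) * P (contraction M F)) = P M + kl_rest P"
  using sum.remove[OF finite_flats empty_in_flats,
      of "\<lambda>F. char_polynomial (restriction M F) * P (contraction M F)"]
  by (simp add: kl_rest_def char_polynomial_restriction_empty contraction_empty)

lemma degree_kl_rest:
  assumes "\<And>F. F \<in> flats M \<Longrightarrow> F \<noteq> {} \<Longrightarrow> degree (P (contraction M F)) \<le> rk (contraction M F)"
  shows "degree (kl_rest P) \<le> rk M"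
  unfolding kl_rest_def
proof (rule degree_sum_le)
  fix F assume "F \<in> flats M - {{}}"
  then have F: "F \<in> flats M" "F \<noteq> {}" by auto
  have "degree (char_polynomial (restriction M F) * P (contraction M F)) \<le>
      degree (char_polynomial (restriction M F)) + degree (P (contraction M F))"
    by (rule degree_mult_le)
  also have "\<dots> \<le> mrank M F + rk (contraction M F)"
    by (intro add_mono degree_char_polynomial_restriction assms F)
  finally show "degree (char_polynomial (restriction M F) * P (contraction M F)) \<le> rk M"
    using rk_contraction[OF F(1)] by simp
qed (simp add: finite_flats)

lemma recip_kl_rest:
  assumes deg: "\<And>F. F \<in> flats M \<Longrightarrow> F \<noteq> {} \<Longrightarrow> degree (P (contraction M F)) \<le> rk (contraction M F)"
    and eqn: "\<And>F. F \<in> flats M \<Longrightarrow> F \<noteq> {} \<Longrightarrow>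
      recip_poly (rk (contraction M F)) (P (contraction M F)) =
      (\<Sum>G\<in>flats (contraction M F). char_polynomial (restriction (contraction M F) G) *
        P (contraction (contraction M F) G))"
  shows "recip_poly (rk M) (kl_rest P) = - kl_rest P"
proof -
  define L where "L = flats M - {{}}"
  have fL: "finite L" using finite_flats by (simp add: L_def)
  define c where "c F = recip_poly (mrank M F) (char_polynomial (restriction M F))" for F
  define x where "x F G = char_polynomial (contraction (restriction M G) F)" for F G
  have split: "degree (char_polynomial (restriction M F) * P (contraction M F)) \<le> rk M \<and>
      recip_poly (rk M) (char_polynomial (restriction M F) * P (contraction M F)) =
      c F * (\<Sum>G | G \<in> flats M \<and> F \<subseteq> G. x F G * P (contraction M G))" if "F \<in> L" for F
  proof
    have F: "F \<in> flats M" "F \<noteq> {}" using that by (auto simp: L_def)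
    note r = rk_contraction[OF F(1)]
    have "degree (char_polynomial (restriction M F) * P (contraction M F)) \<le>
        mrank M F + rk (contraction M F)"
      by (intro order_trans[OF degree_mult_le] add_mono degree_char_polynomial_restriction deg F)
    then show "degree (char_polynomial (restriction M F) * P (contraction M F)) \<le> rk M"
      using r by simp
    have "recip_poly (mrank M F + rk (contraction M F))
        (char_polynomial (restriction M F) * P (contraction M F)) =
        c F * recip_poly (rk (contraction M F)) (P (contraction M F))"
      unfolding c_def by (intro recip_poly_mult degree_char_polynomial_restriction deg F)
    also have "\<dots> = c F * (\<Sum>G | G \<in> flats M \<and> F \<subseteq> G. x F G * P (contraction M G))"
      unfolding x_def eqn[OF F] kl_equation_contraction[OF F(1)] ..
    finally show "recip_poly (rk M) (char_polynomial (restriction M F) * P (contraction M F)) =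
        c F * (\<Sum>G | G \<in> flats M \<and> F \<subseteq> G. x F G * P (contraction M G))"
      using r by (simp add: add.commute)
  qed
  have "recip_poly (rk M) (kl_rest P) =
      (\<Sum>F\<in>L. c F * (\<Sum>G | G \<in> flats M \<and> F \<subseteq> G. x F G * P (contraction M G)))"
    unfolding kl_rest_def L_def[symmetric] using split by (subst recip_poly_sum) auto
  also have "\<dots> = (\<Sum>F\<in>L. \<Sum>G\<in>L. if F \<subseteq> G then c F * x F G * P (contraction M G) else 0)"
  proof (rule sum.cong[OF refl])
    fix F assume "F \<in> L"
    then have F: "F \<noteq> {}" by (auto simp: L_def)
    show "c F * (\<Sum>G | G \<in> flats M \<and> F \<subseteq> G. x F G * P (contraction M G)) =
        (\<Sum>G\<in>L. if F \<subseteq> G then c F * x F G * P (contraction M G) else 0)"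
      unfolding sum_distrib_left using fL F
      by (intro sum.mono_neutral_cong_left) (auto simp: L_def mult.assoc)
  qed
  also have "\<dots> = (\<Sum>G\<in>L. \<Sum>F\<in>L. if F \<subseteq> G then c F * x F G * P (contraction M G) else 0)"
    by (rule sum.swap)
  also have "\<dots> = (\<Sum>G\<in>L. - (char_polynomial (restriction M G) * P (contraction M G)))"
  proof (rule sum.cong[OF refl])
    fix G assume "G \<in> L"
    then have G: "G \<in> flats M" "G \<noteq> {}" by (auto simp: L_def)
    interpret R: matroid "restriction M G" by (rule matroid_restriction[OF flats_subset[OF G(1)]])
    let ?J = "{F. F \<in> flats M \<and> F \<subseteq> G}"
    have "(\<Sum>F\<in>?J. c F * x F G) = 0"
      using char_polynomial_kernel[OF G(1)] G(2) by (simp add: c_def x_def)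
    moreover have "(\<Sum>F\<in>?J. c F * x F G) = c {} * x {} G + (\<Sum>F\<in>?J - {{}}. c F * x F G)"
      using finite_flats empty_in_flats by (intro sum.remove) auto
    moreover have "c {} * x {} G = char_polynomial (restriction M G)"
      by (simp add: c_def x_def R.contraction_empty char_polynomial_restriction_empty mrank_empty
          recip_poly_def)
    ultimately have *: "(\<Sum>F\<in>?J - {{}}. c F * x F G) = - char_polynomial (restriction M G)"
      by (simp add: add_eq_0_iff)
    have "(\<Sum>F\<in>L. if F \<subseteq> G then c F * x F G * P (contraction M G) else 0) =
        (\<Sum>F\<in>?J - {{}}. c F * x F G * P (contraction M G))"
      using fL by (intro sum.mono_neutral_cong_right) (auto simp: L_def)
    also have "\<dots> = - (char_polynomial (restriction M G) * P (contraction M G))"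
      unfolding sum_distrib_right[symmetric] * by simp
    finally show "(\<Sum>F\<in>L. if F \<subseteq> G then c F * x F G * P (contraction M G) else 0) =
        - (char_polynomial (restriction M G) * P (contraction M G))" .
  qed
  also have "\<dots> = - kl_rest P"
    by (simp add: kl_rest_def L_def sum_negf)
  finally show ?thesis .
qed

lemma card_contraction_less:
  assumes "F \<in> flats M" "F \<noteq> {}"
  shows "card (ground (contraction M F)) < card (ground M)"
  using assms flats_subset finite_ground by (auto intro!: psubset_card_mono)

lemma kl_coeff:
  assumes "0 < rk M" "2 * degree (P M) < rk M"
    and "recip_poly (rk M) (P M) = P M + kl_rest P"
  shows "coeff (P M) k = (if 2 * k < rk M then - coeff (kl_rest P) k else 0)"
proof (cases "2 * k < rk M")
  case True
  then have "degree (P M) < rk M - k" using assms(2) by linarith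
  then have "coeff (recip_poly (rk M) (P M)) k = 0"
    using assms(2) True by (subst coeff_recip_poly) (auto simp: coeff_eq_0)
  then show ?thesis using True assms(3) by simp
next
  case False
  then show ?thesis using assms(2) by (simp add: coeff_eq_0)
qed

end

lemma kl_assignment_unique:
  assumes "kl_assignment P" "kl_assignment Q"
  shows "P = Q"
proof (rule extensionalityI)
  show "P \<in> extensional {M. loopless_matroid M}" "Q \<in> extensional {M. loopless_matroid M}"
    using assms by (auto simp: kl_assignment_def)
  fix M :: "'a pre_matroid" assume "M \<in> {M. loopless_matroid M}"
  then have "loopless_matroid M" by simp
  then show "P M = Q M"
  proof (induction "card (ground M)" arbitrary: M rule: less_induct)
    case less
    interpret loopless_matroid M by fact
    show ?case
    proof (cases "rk M = 0")
      case True
      then show ?thesis using assms less.prems by (simp add: kl_assignment_def)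
    next
      case False
      have "P (contraction M F) = Q (contraction M F)" if "F \<in> flats M - {{}}" for F
        using that by (intro less.hyps card_contraction_less loopless_contraction) auto
      then have rest: "kl_rest P = kl_rest Q" by (simp add: kl_rest_def)
      show ?thesis
      proof (rule poly_eqI)
        show "coeff (P M) k = coeff (Q M) k" for k
          using assms less.prems False rest
          by (simp add: kl_assignment_def kl_sum_eq kl_coeff)
      qed
    qed
  qed
qed

text \<open>The low-degree half of the defining equation, used as a recursion.\<close>

function kl_rec :: "'a pre_matroid \<Rightarrow> int poly" where
  "kl_rec M =
     (if loopless_matroid M
      then if ground M = {} then 1
        else - (\<Sum>k | 2 * k < rk M. monom (coeff
          (\<Sum>F\<in>flats M - {{}}. char_polynomial (restriction M F) * kl_rec (contraction M F)) k) k)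
      else undefined)"
  by auto
termination
  by (relation "measure (\<lambda>M. card (ground M))")
    (auto intro: loopless_matroid.card_contraction_less)

declare kl_rec.simps [simp del]

lemma kl_rec_properties:
  assumes "loopless_matroid M"
  shows "(rk M = 0 \<longrightarrow> kl_rec M = 1) \<and> (rk M > 0 \<longrightarrow> 2 * degree (kl_rec M) < rk M) \<and>
    recip_poly (rk M) (kl_rec M) =
      (\<Sum>F\<in>flats M. char_polynomial (restriction M F) * kl_rec (contraction M F))"
  using assms
proof (induction "card (ground M)" arbitrary: M rule: less_induct)
  case less
  interpret loopless_matroid M by fact
  show ?case
  proof (cases "rk M = 0")
    case True
    then have "ground M = {}" by (simp add: rk_eq_0_iff)
    then have "flats M - {{}} = {}" using flats_subset by blast
    then have "kl_rest kl_rec = 0" by (metis kl_rest_def sum.empty)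
    moreover have "kl_rec M = 1"
      using less.prems \<open>ground M = {}\<close> by (subst kl_rec.simps) simp
    ultimately show ?thesis using True by (simp add: kl_sum_eq recip_poly_def)
  next
    case False
    then have ne: "ground M \<noteq> {}" by (simp add: rk_eq_0_iff)
    define Q where "Q = kl_rest kl_rec"
    have IH: "loopless_matroid (contraction M F)"
      "degree (kl_rec (contraction M F)) \<le> rk (contraction M F)"
      "recip_poly (rk (contraction M F)) (kl_rec (contraction M F)) =
        (\<Sum>G\<in>flats (contraction M F). char_polynomial (restriction (contraction M F) G) *
          kl_rec (contraction (contraction M F) G))" if "F \<in> flats M" "F \<noteq> {}" for F
    proof -
      show *: "loopless_matroid (contraction M F)" by (rule loopless_contraction[OF that(1)])
      note ih = less.hyps[OF card_contraction_less[OF that] *]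
      show "degree (kl_rec (contraction M F)) \<le> rk (contraction M F)"
        using ih by (cases "rk (contraction M F) = 0") auto
      show "recip_poly (rk (contraction M F)) (kl_rec (contraction M F)) =
        (\<Sum>G\<in>flats (contraction M F). char_polynomial (restriction (contraction M F) G) *
          kl_rec (contraction (contraction M F) G))"
        using ih by blast
    qed
    have degQ: "degree Q \<le> rk M" unfolding Q_def by (rule degree_kl_rest) (rule IH)
    have recQ: "recip_poly (rk M) Q = - Q" unfolding Q_def by (rule recip_kl_rest) (rule IH; assumption)+
    have anti: "coeff Q (rk M - k) = - coeff Q k" if "k \<le> rk M" for k
      using arg_cong[OF recQ, of "\<lambda>p. coeff p k"] that by (simp add: coeff_recip_poly[OF degQ])
    have fin: "finite {k. 2 * k < rk M}" by (rule finite_subset[of _ "{..rk M}"]) auto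
    have "kl_rec M = - (\<Sum>k | 2 * k < rk M. monom (coeff Q k) k)"
      using less.prems ne by (subst kl_rec.simps) (simp add: Q_def kl_rest_def)
    then have coeffP: "coeff (kl_rec M) k = (if 2 * k < rk M then - coeff Q k else 0)" for k
      using fin by (simp add: coeff_sum sum.delta)
    have "degree (kl_rec M) \<le> (rk M - 1) div 2"
      using False by (intro degree_le) (auto simp: coeffP)
    then have deg: "2 * degree (kl_rec M) < rk M" using False by linarith
    have "recip_poly (rk M) (kl_rec M) = kl_rec M + Q"
    proof (rule poly_eqI)
      fix k
      consider "2 * k < rk M" | "2 * k = rk M" | "rk M < 2 * k" "k \<le> rk M" | "rk M < k" by linarith
      then show "coeff (recip_poly (rk M) (kl_rec M)) k = coeff (kl_rec M + Q) k"
      proof cases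
        case 1
        then show ?thesis using deg by (simp add: coeff_recip_poly coeffP)
      next
        case 2
        then have "rk M - k = k" by linarith
        then have "coeff Q k = 0" using anti[of k] 2 by simp
        then show ?thesis using deg 2 by (simp add: coeff_recip_poly coeffP)
      next
        case 3
        then have "2 * (rk M - k) < rk M" by linarith
        then show ?thesis using deg 3 anti[of k] by (simp add: coeff_recip_poly coeffP)
      next
        case 4
        then show ?thesis using deg degQ by (simp add: coeff_recip_poly coeffP coeff_eq_0)
      qed
    qed
    then show ?thesis using False deg by (simp add: kl_sum_eq Q_def)
  qed
qed

theorem kl_assignment_ex1: "\<exists>!P. kl_assignment P"
proof -
  have "kl_rec \<in> extensional {M. loopless_matroid M}"
    by (auto simp: extensional_def kl_rec.simps)
  then have "kl_assignment kl_rec"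
    unfolding kl_assignment_def using kl_rec_properties by blast
  then show ?thesis using kl_assignment_unique by blast
qed

theorem kl_assignment_kl_poly: "kl_assignment kl_poly"
  unfolding kl_poly_def by (rule theI'[OF kl_assignment_ex1])


subsection \<open>Uniform matroids\<close>

lemma matroid_uniform:
  assumes "finite E"
  shows "matroid (uniform_matroid E d)"
proof
  show "finite (ground (uniform_matroid E d))" using assms by (simp add: uniform_matroid_def)
  show "J \<in> indep (uniform_matroid E d)" if "I \<in> indep (uniform_matroid E d)" "J \<subseteq> I" for I J
    using that assms card_mono[of I J] finite_subset[of I E] by (auto simp: uniform_matroid_def)
  fix I J
  assume IJ: "I \<in> indep (uniform_matroid E d)" "J \<in> indep (uniform_matroid E d)" "card I < card J"
  then have fin: "finite I" "finite J"
    using assms finite_subset by (auto simp: uniform_matroid_def)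
  then have "\<not> J \<subseteq> I" using IJ(3) card_mono[of I J] by auto
  then obtain x where "x \<in> J - I" by blast
  then show "\<exists>x\<in>J - I. insert x I \<in> indep (uniform_matroid E d)"
    using IJ fin by (intro bexI[of _ x]) (auto simp: uniform_matroid_def)
qed (auto simp: uniform_matroid_def)

lemma loopless_uniform:
  assumes "finite E" "d > 0"
  shows "loopless_matroid (uniform_matroid E d)"
proof -
  interpret matroid "uniform_matroid E d" by (rule matroid_uniform[OF assms(1)])
  show ?thesis by unfold_locales (use assms in \<open>auto simp: uniform_matroid_def\<close>)
qed

lemma rk_uniform:
  assumes "finite E" "d \<le> card E"
  shows "rk (uniform_matroid E d) = d"
proof -
  interpret matroid "uniform_matroid E d" by (rule matroid_uniform[OF assms(1)])
  obtain D where D: "D \<subseteq> E" "card D = d" using obtain_subset_with_card_n[OF assms(2)] by metis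
  then have "card D \<le> rk (uniform_matroid E d)"
    by (intro card_le_mrank) (auto simp: uniform_matroid_def)
  moreover obtain B where "B \<in> indep (uniform_matroid E d)" "card B = rk (uniform_matroid E d)"
    by (rule obtain_basis)
  ultimately show ?thesis using D by (auto simp: uniform_matroid_def)
qed

end

theory Submission
  imports Defs "HOL-Computational_Algebra.Formal_Power_Series"
begin

text \<open>
  Put \<open>f\<^sub>i(x) = (1/x) \<Sum>h<m. C(x + h, h + i + 1) C(i - 1 + h, h)\<close>. This is a polynomial of degree
  less than \<open>m + i\<close> in \<open>x\<close> that equals \<open>(-1)\<^sup>i\<close> at \<open>-1, \<dots>, -m\<close> and vanishes at \<open>1, \<dots>, i\<close>, and the
  claimed coefficient is \<open>C(d + m, i) f\<^sub>i(d - i)\<close>. For \<open>2i < d\<close>, comparing coefficients of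
  \<open>t\<^bsup>d-i\<^esup>\<close> in the defining equation expresses \<open>c\<^bsup>i\<^esup>\<close> through the \<open>c\<^bsup>j\<^esup>\<close> with \<open>j < i\<close> only, since
  \<open>(t - 1)\<^sup>k P(t)\<close> with \<open>P\<close> of degree less than \<open>(d - k)/2\<close> has few high coefficients. With \<open>n = d - i\<close>,
  the resulting recursion is the identity
  \<open>f\<^sub>i(n) = (-1)\<^sup>i + (-1)\<^sup>i C(m + n, m) \<Sum>u=1..i. (-1)\<^sup>u C(i, u) / C(m + u, m) \<Sum>j<u. C(n, j) f\<^sub>j(u)\<close>.
  Both sides are polynomials in \<open>n\<close> of degree less than \<open>m + i\<close>, so it suffices to check it at
  \<open>-1, \<dots>, -m\<close> and at \<open>1, \<dots>, i\<close>.
\<close>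

section \<open>Finite differences and special values of \<open>f\<^sub>i\<close>\<close>

text \<open>The sum is, up to sign, the finite difference of order \<open>N\<close> of
  \<open>q\<close> at \<open>a\<close>, which kills degrees below \<open>N\<close>. Both
  \<open>a\<close> and \<open>N\<close> vary in the induction because peeling off a linear factor
  shifts the one and lowers the other.\<close>

lemma alternating_binomial_sum_poly_eq_0:
  fixes q :: "real poly"
  assumes "degree q < N"
  shows "(\<Sum>k\<le>N. (-1) ^ k * real (N choose k) * poly q (a + real k)) = 0"
  using assms
proof (induction q arbitrary: a N)
  case 0
  then show ?case by simp
next
  case (pCons c q)
  obtain n where N: "N = Suc n" using pCons.prems by (cases N) auto
  have alt: "(\<Sum>k\<le>N. (-1) ^ k * real (N choose k)) = 0"
    using choose_alternating_sum[of N, where 'a = real] N by simp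
  show ?case
  proof (cases "q = 0")
    case True
    then show ?thesis using alt by (simp flip: sum_distrib_right)
  next
    case False
    then have deg: "degree q < n" using pCons.prems N by simp
    have "(\<Sum>k\<le>N. (-1) ^ k * real (N choose k) * (real k * poly q (a + real k))) =
        (\<Sum>k\<le>n. (-1) ^ Suc k * real (Suc k * (N choose Suc k)) * poly q (a + real (Suc k)))"
      unfolding N by (subst sum.atMost_Suc_shift) (simp add: algebra_simps)
    \<comment> \<open>Absorption: \<open>k * (N choose k) = N * ((N - 1) choose (k - 1))\<close>
      turns the factor \<open>k\<close> into a difference of order \<open>n = N - 1\<close> based at
      \<open>a + 1\<close>.\<close>
    also have "\<dots> = - real N * (\<Sum>k\<le>n. (-1) ^ k * real (n choose k) * poly q ((a + 1) + real k))"
      unfolding sum_distrib_left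
    proof (intro sum.cong refl)
      fix k
      have "real (Suc k * (N choose Suc k)) = real N * real (n choose k)"
        by (metis N Suc_times_binomial of_nat_mult)
      then show "(-1) ^ Suc k * real (Suc k * (N choose Suc k)) * poly q (a + real (Suc k)) =
          - real N * ((-1) ^ k * real (n choose k) * poly q ((a + 1) + real k))"
        by (simp only:) (simp add: algebra_simps)
    qed
    also have "\<dots> = 0" using pCons.IH[OF deg, of "a + 1"] by simp
    finally have k_part: "(\<Sum>k\<le>N. (-1) ^ k * real (N choose k) * (real k * poly q (a + real k))) = 0" .
    have "(\<Sum>k\<le>N. (-1) ^ k * real (N choose k) * poly (pCons c q) (a + real k)) =
        c * (\<Sum>k\<le>N. (-1) ^ k * real (N choose k)) +
        a * (\<Sum>k\<le>N. (-1) ^ k * real (N choose k) * poly q (a + real k)) +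
        (\<Sum>k\<le>N. (-1) ^ k * real (N choose k) * (real k * poly q (a + real k)))"
      unfolding sum_distrib_left sum.distrib[symmetric]
      by (intro sum.cong refl) (simp add: algebra_simps)
    then show ?thesis
      using k_part pCons.IH[of N a] deg N alt by simp
  qed
qed

text \<open>The polynomial \<open>f\<^sub>i\<close>: the factor \<open>x\<close> of \<open>C(x + h, h + i + 1)\<close> has been cancelled.\<close>

definition interp_poly :: "nat \<Rightarrow> nat \<Rightarrow> real poly" where
  "interp_poly m i = (\<Sum>h<m. smult (((real i - 1 + real h) gchoose h) / fact (h + i + 1))
     ((\<Prod>r<i. [:real r - real i, 1:]) * (\<Prod>r<h. [:real r + 1, 1:])))"

lemma poly_interp_poly:
  "poly (interp_poly m i) x = (\<Sum>h<m. ((real i - 1 + real h) gchoose h) / fact (h + i + 1) *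
     (pochhammer (x - real i) i * pochhammer (x + 1) h))"
  by (simp add: interp_poly_def poly_sum poly_prod pochhammer_prod atLeast0LessThan algebra_simps)

lemma degree_prod_linear_le: "degree (\<Prod>r<n. [:f r, 1:] :: real poly) \<le> n"
  using degree_prod_sum_le[of "{..<n}" "\<lambda>r. [:f r, 1:]"] by simp

lemma degree_interp_poly:
  assumes "m > 0"
  shows "degree (interp_poly m i) < m + i"
proof -
  have "degree (interp_poly m i) \<le> m + i - 1"
    unfolding interp_poly_def
  proof (intro degree_sum_le)
    fix h assume "h \<in> {..<m}"
    then show "degree (smult (((real i - 1 + real h) gchoose h) / fact (h + i + 1))
        ((\<Prod>r<i. [:real r - real i, 1:]) * (\<Prod>r<h. [:real r + 1, 1:]))) \<le> m + i - 1"
      using degree_prod_linear_le[of "\<lambda>r. real r - real i" i]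
        degree_prod_linear_le[of "\<lambda>r. real r + 1" h]
      by (intro order_trans[OF degree_smult_le] order_trans[OF degree_mult_le]) simp
  qed simp
  then show ?thesis using assms by simp
qed

text \<open>The numerator of C(x + h, h + i + 1) is (x - i)...(x - 1) times x times (x + 1)...(x +
  h); the two outer products are the Pochhammer factors of \<open>interp_poly\<close>.\<close>

lemma times_poly_interp_poly:
  "x * poly (interp_poly m i) x =
    (\<Sum>h<m. ((x + real h) gchoose (h + i + 1)) * ((real i - 1 + real h) gchoose h))"
proof -
  have "(x + real h) gchoose (h + i + 1) =
      x * (pochhammer (x - real i) i * pochhammer (x + 1) h) / fact (h + i + 1)" for h
  proof -
    have "pochhammer (x - real i) (i + Suc h) = pochhammer (x - real i) i * (x * pochhammer (x + 1) h)"
      using pochhammer_product'[of "x - real i" i "Suc h"] pochhammer_rec[of x h] by simp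
    then show ?thesis
      by (simp add: gbinomial_pochhammer' add.commute mult.left_commute)
  qed
  then show ?thesis
    by (simp add: poly_interp_poly sum_distrib_left mult_ac)
qed

text \<open>Every summand contains (x - i)...(x - 1). The point 0 is excluded because the factor
  \<open>x\<close> has been cancelled.\<close>

lemma interp_poly_small_nat:
  assumes "0 < p" "p \<le> i"
  shows "poly (interp_poly m i) (real p) = 0"
proof -
  have "real p - real i = - real (i - p)" "i - p < i" using assms by auto
  then have "pochhammer (real p - real i) i = 0" by (metis pochhammer_of_nat_eq_0_iff)
  then show ?thesis by (simp add: poly_interp_poly)
qed

text \<open>Negating upper indices turns the sum into a Vandermonde convolution of C(-i, h) with C(v
  + i, v - 1 - h), whose value is C(v, v - 1) = v.\<close>

lemma interp_poly_neg_nat: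
  assumes "0 < v" "v \<le> m"
  shows "poly (interp_poly m i) (- real v) = (-1) ^ i"
proof -
  obtain w where v: "v = Suc w" using assms by (cases v) auto
  \<comment> \<open>For \<open>h \<ge> v\<close> the upper index is the natural number
    \<open>h - v\<close>, which is below the lower index. As \<open>v \<le> m\<close>, the sum over
    \<open>h < m\<close> can be cut at \<open>w = v - 1\<close>.\<close>
  have zero: "(- real v + real h) gchoose (h + i + 1) = 0" if "\<not> h < v" for h
  proof -
    have "- real v + real h = real (h - v)" using that by simp
    then show ?thesis by (metis binomial_gbinomial binomial_eq_0 of_nat_0 less_imp_diff_less
      add.assoc less_add_Suc1 Suc_eq_plus1 add_Suc_right)
  qed
  have summand: "((- real v + real h) gchoose (h + i + 1)) * ((real i - 1 + real h) gchoose h) =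
     (-1) ^ (i + 1) * (((- real i) gchoose h) * ((real (v + i)) gchoose (w - h)))" if "h \<le> w" for h
  proof -
    have "(- real v + real h) gchoose (h + i + 1) = (-1) ^ (h + i + 1) * (real (v + i) gchoose (h + i + 1))"
      by (subst gbinomial_negated_upper) (simp add: algebra_simps)
    moreover have "real (v + i) gchoose (h + i + 1) = real (v + i) gchoose (w - h)"
    proof -
      have "v + i - (h + i + 1) = w - h" "h + i + 1 \<le> v + i" using that v by auto
      then show ?thesis using gbinomial_of_nat_symmetric[of "h + i + 1" "v + i"] by metis
    qed
    moreover have "(- real i) gchoose h = (-1) ^ h * ((real i - 1 + real h) gchoose h)"
      by (simp add: gbinomial_minus algebra_simps)
    ultimately show ?thesis by (simp add: power_add)
  qed
  have "- real v * poly (interp_poly m i) (- real v) =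
      (\<Sum>h\<in>{0..w}. ((- real v + real h) gchoose (h + i + 1)) * ((real i - 1 + real h) gchoose h))"
    unfolding times_poly_interp_poly using assms v zero
    by (intro sum.mono_neutral_right) auto
  also have "\<dots> = (-1) ^ (i + 1) * (\<Sum>h\<in>{0..w}. ((- real i) gchoose h) * ((real (v + i)) gchoose (w - h)))"
    unfolding sum_distrib_left by (intro sum.cong refl summand) auto
  also have "\<dots> = (-1) ^ (i + 1) * (real v gchoose w)"
    by (simp add: gbinomial_Vandermonde)
  also have "real v gchoose w = real v"
    unfolding v by (simp flip: binomial_gbinomial del: of_nat_Suc)
  finally show ?thesis using assms by simp
qed

text \<open>Among the points from \<open>-m\<close> to \<open>i\<close>, 0 is the only one not
  covered by the two preceding lemmas. For \<open>i > 0\<close> the sum telescopes, since i / ((h +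
  i)(h + i + 1)) = i / (h + i) - i / (h + i + 1). For \<open>i = 0\<close> this expression is
  undefined at \<open>h = 0\<close>, and only that summand of the original sum survives.\<close>

lemma interp_poly_0:
  assumes "m > 0"
  shows "poly (interp_poly m i) 0 = (-1) ^ i * (real m / (real m + real i))"
proof -
  have poch: "pochhammer (- real i) i = (-1) ^ i * fact i"
    by (simp add: pochhammer_minus pochhammer_fact)
  show ?thesis
  proof (cases i)
    case 0
    have "poly (interp_poly m 0) 0 = (\<Sum>h<m. if h = 0 then 1 else 0)"
      unfolding poly_interp_poly
    proof (intro sum.cong refl)
      fix h show "((real 0 - 1 + real h) gchoose h) / fact (h + 0 + 1) *
         (pochhammer (0 - real 0) 0 * pochhammer (0 + 1) h) = (if h = 0 then 1 else 0)"
      proof (cases h)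
        case (Suc k)
        then have "(real 0 - 1 + real h) gchoose h = real (k choose h)"
          by (simp add: binomial_gbinomial)
        then show ?thesis using Suc by simp
      qed simp
    qed
    then show ?thesis using 0 assms by simp
  next
    case (Suc k)
    have gb: "(real i - 1 + real h) gchoose h = fact (k + h) / (fact k * fact h)" for h
    proof -
      have "real i - 1 + real h = real (k + h)" using Suc by simp
      then have "(real i - 1 + real h) gchoose h = real ((k + h) choose h)"
        by (simp only: binomial_gbinomial)
      then show ?thesis by (simp add: binomial_fact)
    qed
    have "poly (interp_poly m i) 0 =
       (\<Sum>h<m. (-1) ^ i * (real i / ((real h + real i + 1) * (real h + real i))))"
      unfolding poly_interp_poly
    proof (intro sum.cong refl)
      fix h
      have f: "fact (h + i + 1) = (real h + real i + 1) * ((real h + real i) * fact (k + h) :: real)"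
        using Suc by (simp add: algebra_simps)
      have fi: "(fact i :: real) = real i * fact k" using Suc by simp
      have fh: "pochhammer 1 h = (fact h :: real)" by (simp add: pochhammer_fact)
      have nz: "real h + real i \<noteq> 0" "real h + real i + 1 \<noteq> 0" using Suc by auto
      show "((real i - 1 + real h) gchoose h) / fact (h + i + 1) *
          (pochhammer (0 - real i) i * pochhammer (0 + 1) h) =
          (-1) ^ i * (real i / ((real h + real i + 1) * (real h + real i)))"
        unfolding gb f using nz by (simp add: poch fh fi)
    qed
    also have "\<dots> = (-1) ^ i * (real m / (real m + real i))"
    proof (induction m)
      case 0
      then show ?case by simp
    next
      case (Suc m)
      have nz: "real m + real i \<noteq> 0" "real m + real i + 1 \<noteq> 0" using \<open>i = Suc k\<close> by auto
      have "real m / (real m + real i) + real i / ((real m + real i + 1) * (real m + real i)) =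
          (real m + 1) / (real m + real i + 1)"
        using nz by (simp add: divide_simps) (simp add: algebra_simps)
      then have "(-1) ^ i * (real m / (real m + real i)) +
          (-1) ^ i * (real i / ((real m + real i + 1) * (real m + real i))) =
          (-1) ^ i * ((real m + 1) / (real m + real i + 1))"
        by (simp only: flip: distrib_left)
      then show ?case using Suc by (simp add: add_ac)
    qed
    finally show ?thesis .
  qed
qed

section \<open>The recursion for \<open>f\<^sub>i\<close>\<close>

lemma choose_add_eq_fact: "real ((a + b) choose a) = fact (a + b) / (fact a * fact b)"
  by (simp add: binomial_fact)

text \<open>After division by \<open>m\<close>, the left side \<open>?S p m\<close> is, up to sign,
  the difference of order \<open>p\<close> of 1 / (m + x) at 0. Pascal's rule gives
  \<open>?S (Suc p) m = ?S p m - ?S p (Suc m)\<close>, hence the induction over \<open>p\<close>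
  with \<open>m\<close> arbitrary.\<close>

lemma alternating_sum_binomial_shifted_reciprocal:
  assumes "m > 0"
  shows "(\<Sum>j\<le>p. (-1) ^ j * real (p choose j) * (real m / (real m + real j))) =
    1 / real ((m + p) choose m)"
  using assms
proof (induction p arbitrary: m)
  case 0
  then show ?case by simp
next
  case (Suc p)
  let ?S = "\<lambda>p m. \<Sum>j\<le>p. (-1) ^ j * real (p choose j) / (real m + real j)"
  have IH: "?S p m = 1 / (real m * real ((m + p) choose m))" if "m > 0" for m
  proof -
    have "real m * ?S p m = 1 / real ((m + p) choose m)"
      using Suc.IH[OF that] by (simp add: sum_distrib_left mult_ac)
    then show ?thesis using that by (simp add: field_simps)
  qed
  have "?S (Suc p) m = ?S p m - ?S p (Suc m)"
  proof -
    have "?S (Suc p) m = 1 / real m + (\<Sum>j\<le>p. (-1) ^ Suc j * real (Suc p choose Suc j) / (real m + real (Suc j)))"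
      by (subst sum.atMost_Suc_shift) simp
    also have "\<dots> = (1 / real m + (\<Sum>j\<le>p. (-1) ^ Suc j * real (p choose Suc j) / (real m + real (Suc j)))) - ?S p (Suc m)"
      unfolding add_diff_eq[symmetric] sum_subtractf[symmetric]
      by (intro arg_cong2[of _ _ _ _ "(+)"] refl sum.cong) (simp_all add: algebra_simps add_divide_distrib diff_divide_distrib)
    also have "1 / real m + (\<Sum>j\<le>p. (-1) ^ Suc j * real (p choose Suc j) / (real m + real (Suc j))) =
        (\<Sum>j\<le>Suc p. (-1) ^ j * real (p choose j) / (real m + real j))"
      by (subst sum.atMost_Suc_shift) simp
    also have "\<dots> = ?S p m" by simp
    finally show ?thesis .
  qed
  also have "\<dots> = 1 / (real m * real ((m + Suc p) choose m))"
  proof -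
    have "real ((Suc m + p) choose Suc m) =
        (real m + real p + 1) * fact (m + p) / ((1 + real m) * fact m * fact p)"
      "real ((m + Suc p) choose m) =
        (real m + real p + 1) * fact (m + p) / (fact m * ((real p + 1) * fact p))"
      unfolding choose_add_eq_fact by (simp_all add: add_ac)
    then have "?S p m - ?S p (Suc m) = fact m * fact p / fact (m + p) *
        (1 / real m - 1 / (real m + real p + 1))"
      using Suc.prems IH[of m] IH[of "Suc m"] unfolding choose_add_eq_fact
      by (simp add: right_diff_distrib mult.commute)
    also have "1 / real m - 1 / (real m + real p + 1) = (real p + 1) / (real m * (real m + real p + 1))"
      using Suc.prems by (simp add: divide_simps)
    finally show ?thesis
      unfolding \<open>real ((m + Suc p) choose m) = _\<close> by (simp add: mult_ac)
  qed
  finally have "?S (Suc p) m = 1 / (real m * real ((m + Suc p) choose m))" .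
  then have "real m * ?S (Suc p) m = 1 / real ((m + Suc p) choose m)" using Suc.prems by simp
  then have "(\<Sum>j\<le>Suc p. real m * ((-1) ^ j * real (Suc p choose j) / (real m + real j))) =
      1 / real ((m + Suc p) choose m)"
    by (simp only: sum_distrib_left)
  moreover have "real m * (x / y) = x * (real m / y)" for x y by simp
  ultimately show ?case by (simp only:)
qed

text \<open>The shift \<open>a\<close> covers both C(x, j), with \<open>a = 0\<close>, and C(m + x,
  m), with \<open>a = m\<close>.\<close>

definition gchoose_poly :: "real \<Rightarrow> nat \<Rightarrow> real poly" where
  "gchoose_poly a k = smult (1 / fact k) (\<Prod>r<k. [:a - real r, 1:])"

lemma poly_gchoose_poly: "poly (gchoose_poly a k) x = (a + x) gchoose k"
  by (simp add: gchoose_poly_def poly_prod gbinomial_prod_rev atLeast0LessThan algebra_simps)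

lemma degree_gchoose_poly_le: "degree (gchoose_poly a k) \<le> k"
  unfolding gchoose_poly_def
  by (rule order_trans[OF degree_smult_le degree_prod_linear_le])

text \<open>This is the recursion at a point \<open>p\<close> where \<open>f\<^sub>i\<close>
  vanishes. It follows from the auxiliary polynomial \<open>T\<close>, the sum of C(p, j)
  \<open>f\<^sub>j\<close>: at \<open>-1, ..., -m\<close> every \<open>f\<^sub>j\<close> is
  \<open>(-1) ^ j\<close>, so \<open>T\<close> vanishes there as an alternating sum of binomial
  coefficients.\<close>

lemma sum_interp_poly_small_nat:
  assumes "m > 0" "0 < p" "p \<le> i"
  shows "(\<Sum>u=1..i. (-1) ^ u * real (i choose u) / real ((m + u) choose m) *
      (\<Sum>j<u. real (p choose j) * poly (interp_poly m j) (real u))) = - 1 / real ((m + p) choose m)"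
proof -
  define T where "T = (\<Sum>j\<le>p. smult (real (p choose j)) (interp_poly m j))"
  have polyT: "poly T x = (\<Sum>j\<le>p. real (p choose j) * poly (interp_poly m j) x)" for x
    by (simp add: T_def poly_sum)
  have "degree T \<le> m + i - 1"
    unfolding T_def
  proof (intro degree_sum_le)
    fix j assume "j \<in> {..p}"
    then show "degree (smult (real (p choose j)) (interp_poly m j)) \<le> m + i - 1"
      using degree_interp_poly[OF assms(1), of j] assms
      by (intro order_trans[OF degree_smult_le]) simp
  qed simp
  then have degT: "degree T < m + i" using assms by simp
  have T_neg: "poly T (- real v) = 0" if "0 < v" "v \<le> m" for v
    using choose_alternating_sum[of p, where 'a = real] assms that
    by (simp add: polyT interp_poly_neg_nat mult.commute)
  have T_0: "poly T 0 = 1 / real ((m + p) choose m)"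
    using alternating_sum_binomial_shifted_reciprocal[OF assms(1), of p] assms(1)
    by (simp add: polyT interp_poly_0 mult_ac)
  \<comment> \<open>The difference of order \<open>m + i\<close> of \<open>T\<close> over \<open>-m, \<dots>, i\<close> vanishes, and only the nodes
    \<open>0, \<dots>, i\<close> contribute to it.\<close>
  let ?g = "\<lambda>k. (-1) ^ k * real ((m + i) choose k) * poly T (- real m + real k)"
  have "0 = (\<Sum>k\<le>m + i. ?g k)"
    using alternating_binomial_sum_poly_eq_0[OF degT, of "- real m"] by simp
  also have "\<dots> = (\<Sum>k\<in>{m..m + i}. ?g k)"
  proof (intro sum.mono_neutral_right ballI)
    fix k assume "k \<in> {..m + i} - {m..m + i}"
    then have "- real m + real k = - real (m - k)" and v: "0 < m - k" "m - k \<le> m" by auto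
    then show "?g k = 0" using T_neg[OF v] by (simp only: mult_zero_right)
  qed auto
  also have "\<dots> = (\<Sum>u\<in>{0..i}. ?g (u + m))"
    using sum.shift_bounds_cl_nat_ivl[of ?g 0 m i] by (simp add: add.commute)
  \<comment> \<open>C(m + i, m + u) C(m + u, m) = C(m + i, m) C(i, u) extracts a nonzero constant,
    which is then cancelled.\<close>
  also have "\<dots> = (\<Sum>u\<in>{0..i}. (-1) ^ m * real ((m + i) choose m) *
      ((-1) ^ u * real (i choose u) / real ((m + u) choose m) * poly T (real u)))"
  proof (intro sum.cong refl)
    fix u assume "u \<in> {0..i}"
    then have "((m + i) choose (u + m)) * ((m + u) choose m) = ((m + i) choose m) * (i choose u)"
      using choose_mult[of m "m + u" "m + i"] by (simp add: add.commute)
    then have "real ((m + i) choose (u + m)) * real ((m + u) choose m) =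
        real ((m + i) choose m) * real (i choose u)"
      by (metis of_nat_mult)
    moreover have "real ((m + u) choose m) \<noteq> 0" by simp
    ultimately have "real ((m + i) choose (u + m)) =
        real ((m + i) choose m) * real (i choose u) / real ((m + u) choose m)"
      by (simp only: eq_divide_eq) simp
    then show "?g (u + m) = (-1) ^ m * real ((m + i) choose m) *
      ((-1) ^ u * real (i choose u) / real ((m + u) choose m) * poly T (real u))"
      by (simp add: power_add)
  qed
  also have "\<dots> = (-1) ^ m * real ((m + i) choose m) *
      (\<Sum>u\<in>{0..i}. (-1) ^ u * real (i choose u) / real ((m + u) choose m) * poly T (real u))"
    by (simp only: sum_distrib_left)
  finally have "(\<Sum>u\<in>{0..i}. (-1) ^ u * real (i choose u) / real ((m + u) choose m) * poly T (real u)) = 0"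
    by simp
  then have "(\<Sum>u=1..i. (-1) ^ u * real (i choose u) / real ((m + u) choose m) * poly T (real u)) =
      - poly T 0"
    by (subst (asm) sum.atLeast_Suc_atMost) simp_all
  \<comment> \<open>The ranges \<open>j < u\<close> and \<open>j \<le> p\<close> give the same sum:
    \<open>f\<^sub>j(u)\<close> is 0 for \<open>u \<le> j\<close>, and C(p, j) is 0 for
    \<open>j > p\<close>.\<close>
  moreover have "(\<Sum>j<u. real (p choose j) * poly (interp_poly m j) (real u)) = poly T (real u)"
    if "u \<in> {1..i}" for u
    unfolding polyT using that
    by (intro sum.mono_neutral_cong) (auto intro: interp_poly_small_nat)
  ultimately show ?thesis using T_0 by simp
qed

lemma interp_poly_recursion:
  assumes "m > 0"
  shows "poly (interp_poly m i) (real n) = (-1) ^ i + (-1) ^ i * real ((m + n) choose m) *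
    (\<Sum>u=1..i. (-1) ^ u * real (i choose u) / real ((m + u) choose m) *
      (\<Sum>j<u. real (n choose j) * poly (interp_poly m j) (real u)))"
proof -
  define w where "w u = (-1) ^ u * real (i choose u) / real ((m + u) choose m)" for u
  define S where "S = (\<Sum>u=1..i. smult (w u)
      (\<Sum>j<u. smult (poly (interp_poly m j) (real u)) (gchoose_poly 0 j)))"
  \<comment> \<open>The right-hand side as a polynomial in \<open>n\<close>; \<open>A\<close> below
    consists of the \<open>m + i\<close> nonzero integers from \<open>-m\<close> to
    \<open>i\<close>.\<close>
  define R where "R = [:(-1) ^ i:] + smult ((-1) ^ i) (gchoose_poly (real m) m * S)"
  have polyR: "poly R x = (-1) ^ i + (-1) ^ i * ((real m + x) gchoose m) *
      (\<Sum>u=1..i. w u * (\<Sum>j<u. (x gchoose j) * poly (interp_poly m j) (real u)))" for x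
    by (simp add: R_def S_def poly_sum poly_gchoose_poly mult_ac)
  define A where "A = real_of_int ` ({- int m..int i} - {0})"
  have "card A = m + i"
    unfolding A_def by (subst card_image) (auto simp: inj_on_def)
  have degS: "degree S \<le> i - 1"
    unfolding S_def
  proof (intro degree_sum_le order_trans[OF degree_smult_le])
    fix u j assume "u \<in> {1..i}" "j \<in> {..<u}"
    then show "degree (gchoose_poly 0 j) \<le> i - 1"
      using degree_gchoose_poly_le[of 0 j] by simp
  qed auto
  \<comment> \<open>For \<open>i = 0\<close> the truncated bound \<open>m + (i - 1)\<close> would
    only give \<open>m\<close>, one too many; there the sum \<open>S\<close> is empty.\<close>
  have degR: "degree R < m + i"
  proof (cases "i = 0")
    case True
    then have "R = 1" by (simp add: R_def S_def)
    then show ?thesis using assms by simp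
  next
    case False
    have "degree R \<le> m + (i - 1)"
      unfolding R_def
      by (intro degree_add_le order_trans[OF degree_smult_le] order_trans[OF degree_mult_le]
          add_mono degree_gchoose_poly_le degS) simp
    then show ?thesis using False by simp
  qed
  have "interp_poly m i = R"
  proof (rule poly_eqI_degree[of A])
    fix x assume "x \<in> A"
    then obtain z where z: "x = real_of_int z" "z \<in> {- int m..int i} - {0}"
      unfolding A_def by blast
    show "poly (interp_poly m i) x = poly R x"
    proof (cases "z > 0")
      case True
      define p where "p = nat z"
      have p: "x = real p" "0 < p" "p \<le> i" using True z by (auto simp: p_def)
      have "(real m + real p) gchoose m = real ((m + p) choose m)"
        by (simp add: binomial_gbinomial)
      moreover have "real p gchoose j = real (p choose j)" for j
        by (simp add: binomial_gbinomial)
      ultimately have "poly R x = 0"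
        using sum_interp_poly_small_nat[OF assms p(2,3)] unfolding polyR p(1) w_def by simp
      then show ?thesis using interp_poly_small_nat[OF p(2,3)] p(1) by simp
    next
      case False
      define v where "v = nat (- z)"
      have v: "x = - real v" "0 < v" "v \<le> m" using False z by (auto simp: v_def)
      \<comment> \<open>At \<open>x = -v\<close> the factor C(m + x, m) becomes C(m - v, m) = 0,
        which leaves only the constant \<open>(-1) ^ i\<close>.\<close>
      have "(real m + x) gchoose m = real ((m - v) choose m)"
        using v by (simp add: binomial_gbinomial of_nat_diff)
      then have "(real m + x) gchoose m = 0" using v assms by simp
      then show ?thesis using interp_poly_neg_nat[OF v(2,3), of i] by (simp add: polyR v(1))
    qed
  qed (use \<open>card A = m + i\<close> degR degree_interp_poly[OF assms] in auto)
  then have "poly (interp_poly m i) (real n) = poly R (real n)" by simp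
  also have "(real m + real n) gchoose m = real ((m + n) choose m)"
    by (simp add: binomial_gbinomial)
  then have "poly R (real n) = (-1) ^ i + (-1) ^ i * real ((m + n) choose m) *
      (\<Sum>u=1..i. w u * (\<Sum>j<u. real (n choose j) * poly (interp_poly m j) (real u)))"
    by (simp add: polyR binomial_gbinomial)
  finally show ?thesis unfolding w_def .
qed

section \<open>The recursion for the coefficients\<close>

definition uniform_kl_coeff :: "nat \<Rightarrow> nat \<Rightarrow> nat \<Rightarrow> real" where
  "uniform_kl_coeff m d i = real ((m + d) choose i) * poly (interp_poly m i) (real (d - i))"

text \<open>Both sides are multinomial coefficients, with \<open>n = j + a\<close>, \<open>i = u + b\<close> and \<open>d = n + i\<close>.\<close>

lemma multinomial_rearrange:
  "real ((m + (j + a + (u + b))) choose (a + b)) * real ((m + (u + j)) choose j) * real ((a + b) choose a) =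
    real ((m + (j + a + (u + b))) choose (u + b)) * real ((m + (j + a)) choose m) *
    real ((u + b) choose u) / real ((m + u) choose m) * real ((j + a) choose j)"
proof -
  have 1: "(m + (j + a + (u + b))) choose (a + b) = ((a + b) + (m + u + j)) choose (a + b)"
    "(m + (j + a + (u + b))) choose (u + b) = ((u + b) + (m + j + a)) choose (u + b)"
    "(m + (u + j)) choose j = (j + (m + u)) choose j"
    by (simp_all add: add_ac)
  have 2: "(a + b) + (m + u + j) = m + u + j + a + b" "(u + b) + (m + j + a) = m + u + j + a + b"
    "j + (m + u) = m + u + j" "m + (j + a) = m + j + a"
    by simp_all
  show ?thesis unfolding 1 choose_add_eq_fact unfolding 2 by (simp add: mult_ac)
qed

text \<open>The sum over \<open>j\<close> is the coefficient of degree \<open>d - i\<close> in the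
  product of (t - 1)^k with the polynomial claimed for rank \<open>d - k\<close>. The lemma is
  \<open>interp_poly_recursion\<close> at \<open>n = d - i\<close>, multiplied by C(m + d, i) and
  reindexed.\<close>

lemma uniform_kl_coeff_recursion:
  assumes "m > 0" "2 * i < d"
  shows "uniform_kl_coeff m d i = (-1) ^ i * real ((m + d) choose i) +
    (\<Sum>k=1..<d. real ((m + d) choose k) * (\<Sum>j\<le>d - i.
      (if 2 * j < d - k then uniform_kl_coeff m (d - k) j else 0) *
      (if d - i - j \<le> k then real (k choose (d - i - j)) * (-1) ^ (k - (d - i - j)) else 0)))"
proof -
  define n where "n = d - i"
  have d: "d = n + i" "i < n" using assms by (auto simp: n_def)
  define g where "g k j = real ((m + d) choose k) * (uniform_kl_coeff m (d - k) j *
      (real (k choose (n - j)) * (-1) ^ (k - (n - j))))" for k j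
  define A where "A = {(k, j). k \<in> {1..<d} \<and> j \<le> n \<and> 2 * j < d - k \<and> n - j \<le> k}"
  define B where "B = (SIGMA u:{1..i}. {..<u})"
  define h where "h u j = real ((m + d) choose i) * ((-1) ^ i * real ((m + n) choose m) *
      ((-1) ^ u * real (i choose u) / real ((m + u) choose m) *
      (real (n choose j) * poly (interp_poly m j) (real u))))" for u j
  have "(\<Sum>k=1..<d. real ((m + d) choose k) * (\<Sum>j\<le>n.
      (if 2 * j < d - k then uniform_kl_coeff m (d - k) j else 0) *
      (if n - j \<le> k then real (k choose (n - j)) * (-1) ^ (k - (n - j)) else 0))) =
      (\<Sum>k=1..<d. \<Sum>j\<le>n. if (k, j) \<in> A then g k j else 0)"
    unfolding sum_distrib_left by (intro sum.cong refl) (auto simp: A_def g_def)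
  also have "\<dots> = (\<Sum>(k, j)\<in>{1..<d} \<times> {..n}. if (k, j) \<in> A then g k j else 0)"
    by (rule sum.cartesian_product)
  also have "\<dots> = (\<Sum>(k, j)\<in>A. g k j)"
    by (rule sum.mono_neutral_cong_right) (auto simp: A_def split: if_splits)
  also have "\<dots> = (\<Sum>(u, j)\<in>B. h u j)"
  \<comment> \<open>With \<open>u = d - k - j\<close>, the degree bound \<open>2 * j < d - k\<close>
    becomes \<open>j < u\<close>, and \<open>n - j \<le> k\<close> becomes
    \<open>u \<le> i\<close>.\<close>
  proof (rule sum.reindex_bij_witness[where j = "\<lambda>(k, j). (d - k - j, j)" and i = "\<lambda>(u, j). (d - u - j, j)"])
    fix q assume "q \<in> A"
    then obtain k j where q: "q = (k, j)" and
      kj: "1 \<le> k" "k < d" "j \<le> n" "2 * j < d - k" "n - j \<le> k"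
      by (auto simp: A_def)
    define u where "u = d - k - j"
    \<comment> \<open>Writing \<open>n = j + a\<close> and \<open>i = u + b\<close> removes all
      truncated subtractions, as \<open>multinomial_rearrange\<close> requires.\<close>
    define a where "a = n - j"
    define b where "b = i - u"
    have ui: "u \<le> i" "1 \<le> u" "j < u" using kj d by (auto simp: u_def)
    have eqs: "n = j + a" "i = u + b" "k = a + b" "d - k = u + j" "n - j = a" "k - (n - j) = i - u"
      "d = j + a + (u + b)"
      using kj d ui by (auto simp: u_def a_def b_def)
    show "(case case q of (k, j) \<Rightarrow> (d - k - j, j) of (u, j) \<Rightarrow> (d - u - j, j)) = q"
      using q kj by auto
    show "(case q of (k, j) \<Rightarrow> (d - k - j, j)) \<in> B"
      using ui by (auto simp: q B_def u_def)
    have sgn: "(-1) ^ (i - u) = (-1) ^ i * (-1 :: real) ^ u"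
    proof -
      have "(-1 :: real) ^ i = (-1) ^ (i - u) * (-1) ^ u"
        using ui by (simp flip: power_add)
      then show ?thesis by (simp add: mult.assoc)
    qed
    have "g k j = (real ((m + d) choose k) * real ((m + (u + j)) choose j) * real (k choose (n - j))) *
        ((-1) ^ (i - u) * poly (interp_poly m j) (real u))"
      using eqs(4,6) by (simp add: g_def uniform_kl_coeff_def)
    also have "real ((m + d) choose k) * real ((m + (u + j)) choose j) * real (k choose (n - j)) =
        real ((m + d) choose i) * real ((m + n) choose m) *
        real (i choose u) / real ((m + u) choose m) * real (n choose j)"
      using multinomial_rearrange[of m j a u b] eqs by metis
    finally have "g k j = h u j" by (simp add: h_def sgn mult_ac)
    then show "(case case q of (k, j) \<Rightarrow> (d - k - j, j) of (u, j) \<Rightarrow> h u j) = (case q of (k, j) \<Rightarrow> g k j)"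
      by (simp add: q u_def)
  next
    fix q assume "q \<in> B"
    then obtain u j where q: "q = (u, j)" and uj: "1 \<le> u" "u \<le> i" "j < u" by (auto simp: B_def)
    then show "(case case q of (u, j) \<Rightarrow> (d - u - j, j) of (k, j) \<Rightarrow> (d - k - j, j)) = q"
      using d by auto
    show "(case q of (u, j) \<Rightarrow> (d - u - j, j)) \<in> A"
      using uj d by (auto simp: q A_def)
  qed
  also have "\<dots> = (\<Sum>u=1..i. \<Sum>j<u. h u j)"
    unfolding B_def by (rule sum.Sigma[symmetric]) auto
  also have "\<dots> = real ((m + d) choose i) * ((-1) ^ i * real ((m + n) choose m) *
      (\<Sum>u=1..i. (-1) ^ u * real (i choose u) / real ((m + u) choose m) *
      (\<Sum>j<u. real (n choose j) * poly (interp_poly m j) (real u))))"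
    unfolding h_def by (simp only: sum_distrib_left)
  finally show ?thesis
    using interp_poly_recursion[OF assms(1), of i n]
    unfolding uniform_kl_coeff_def n_def[symmetric] by (simp add: distrib_left mult.commute)
qed

section \<open>Flats, minors and characteristic polynomials of uniform matroids\<close>

lemma sum_subsets_by_card:
  fixes g :: "nat \<Rightarrow> 'b::semiring_1"
  assumes "finite E"
  shows "(\<Sum>F | F \<subseteq> E \<and> card F < d. g (card F)) = (\<Sum>k<d. of_nat (card E choose k) * g k)"
proof -
  let ?S = "{F. F \<subseteq> E \<and> card F < d}"
  have fin: "finite ?S" using assms by simp
  have "(\<Sum>F\<in>?S. g (card F)) = (\<Sum>k<d. \<Sum>F\<in>{F \<in> ?S. card F = k}. g (card F))"
    using fin by (intro sum.group[symmetric]) auto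
  also have "\<dots> = (\<Sum>k<d. of_nat (card E choose k) * g k)"
  proof (intro sum.cong refl)
    fix k assume "k \<in> {..<d}"
    then have "{F \<in> ?S. card F = k} = {F. F \<subseteq> E \<and> card F = k}" by auto
    then show "(\<Sum>F\<in>{F \<in> ?S. card F = k}. g (card F)) = of_nat (card E choose k) * g k"
      using n_subsets[OF assms, of k] by simp
  qed
  finally show ?thesis .
qed

lemma sum_Pow_by_card:
  fixes g :: "nat \<Rightarrow> 'b::semiring_1"
  assumes "finite E"
  shows "(\<Sum>F\<in>Pow E. g (card F)) = (\<Sum>k\<le>card E. of_nat (card E choose k) * g k)"
proof -
  have "Pow E = {F. F \<subseteq> E \<and> card F < Suc (card E)}"
    using assms card_mono by (auto simp: less_Suc_eq_le)
  then show ?thesis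
    using sum_subsets_by_card[OF assms, where d = "Suc (card E)" and g = g] by (simp add: lessThan_Suc_atMost)
qed

lemma mrank_uniform:
  assumes "finite E" "X \<subseteq> E"
  shows "mrank (uniform_matroid E d) X = min (card X) d"
proof -
  interpret matroid "uniform_matroid E d" by (rule matroid_uniform[OF assms(1)])
  have finX: "finite X" using assms finite_subset by blast
  obtain B where B: "B \<in> indep (uniform_matroid E d)" "B \<subseteq> X" "card B = mrank (uniform_matroid E d) X"
    by (rule obtain_basis)
  then have "mrank (uniform_matroid E d) X \<le> min (card X) d"
    using card_mono[OF finX B(2)] by (auto simp: uniform_matroid_def)
  moreover obtain D where D: "D \<subseteq> X" "card D = min (card X) d"
    using obtain_subset_with_card_n[of "min (card X) d" X] by auto
  moreover from D have "card D \<le> mrank (uniform_matroid E d) X"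
    using assms by (intro card_le_mrank) (auto simp: uniform_matroid_def)
  ultimately show ?thesis by linarith
qed

text \<open>The rank is \<open>min (card F) d\<close>, so a new element raises it exactly while
  \<open>card F < d\<close>.\<close>

lemma flats_uniform:
  assumes "finite E"
  shows "flats (uniform_matroid E d) = insert E {F. F \<subseteq> E \<and> card F < d}"
proof -
  have ground: "ground (uniform_matroid E d) = E" by (simp add: uniform_matroid_def)
  have "mrank (uniform_matroid E d) F < mrank (uniform_matroid E d) (insert x F) \<longleftrightarrow> card F < d"
    if "F \<subseteq> E" "x \<in> E - F" for F x
  proof -
    have "finite F" using that assms finite_subset by blast
    then show ?thesis using that assms by (auto simp: mrank_uniform)
  qed
  then show ?thesis unfolding flats_def ground by auto
qed

text \<open>\<open>F\<close> is independent, hence its own only basis. The result is an equality of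
  matroids, so an induction over all ground sets applies without invariance of
  \<open>kl_poly\<close> under isomorphism.\<close>

lemma contraction_uniform:
  assumes "finite E" "F \<subseteq> E" "card F \<le> d"
  shows "contraction (uniform_matroid E d) F = uniform_matroid (E - F) (d - card F)"
proof -
  have finF: "finite F" using assms finite_subset by blast
  have "(\<exists>B\<in>indep (uniform_matroid E d). B \<subseteq> F \<and> card B = mrank (uniform_matroid E d) F \<and>
      I \<union> B \<in> indep (uniform_matroid E d)) \<longleftrightarrow> card I \<le> d - card F" if I: "I \<subseteq> E - F" for I
  proof -
    have "finite I" using I assms finite_subset by blast
    then have card_Un: "card (I \<union> F) = card I + card F"
      using I finF by (intro card_Un_disjoint) auto
    have rank: "mrank (uniform_matroid E d) F = card F" using assms by (simp add: mrank_uniform)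
    have B: "B = F" if "B \<subseteq> F" "card B = card F" for B
      using that finF by (intro card_subset_eq)
    have indep: "F \<in> indep (uniform_matroid E d)"
      "I \<union> F \<in> indep (uniform_matroid E d) \<longleftrightarrow> card I \<le> d - card F"
      using assms I card_Un by (auto simp: uniform_matroid_def)
    show ?thesis unfolding rank using B indep by blast
  qed
  then have "{I. I \<subseteq> E - F \<and> (\<exists>B\<in>indep (uniform_matroid E d). B \<subseteq> F \<and>
      card B = mrank (uniform_matroid E d) F \<and> I \<union> B \<in> indep (uniform_matroid E d))} =
      {I. I \<subseteq> E - F \<and> card I \<le> d - card F}"
    by blast
  moreover have "ground (uniform_matroid E d) = E" by (simp add: uniform_matroid_def)
  ultimately show ?thesis
    by (simp only: contraction_def uniform_matroid_def[of "E - F"])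
qed

text \<open>All subsets of \<open>H\<close> are flats, so the interval below \<open>H\<close> is
  Boolean.\<close>

lemma mobius_flats_uniform:
  assumes "finite E" "0 < d" "H \<subseteq> E" "card H < d"
  shows "mobius (flats (uniform_matroid E d)) {} H = (-1) ^ card H"
  using assms(3,4)
proof (induction "card H" arbitrary: H rule: less_induct)
  case less
  have finH: "finite H" using less.prems assms finite_subset by blast
  let ?\<mu> = "mobius (flats (uniform_matroid E d)) {}"
  show ?case
  proof (cases "H = {}")
    case False
    have sets: "{C. C \<in> flats (uniform_matroid E d) \<and> {} \<subseteq> C \<and> C \<subset> H} = Pow H - {H}"
    proof -
      have "card C < d" if "C \<subseteq> H" for C
        using card_mono[OF finH that] less.prems by simp
      then show ?thesis
        using less.prems unfolding flats_uniform[OF assms(1)] by auto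
    qed
    have "?\<mu> H = - (\<Sum>C\<in>Pow H - {H}. ?\<mu> C)"
      using False finH by (subst mobius.simps) (auto simp: sets[simplified])
    also have "(\<Sum>C\<in>Pow H - {H}. ?\<mu> C) = (\<Sum>C\<in>Pow H - {H}. (-1) ^ card C)"
    proof (intro sum.cong refl)
      fix C assume "C \<in> Pow H - {H}"
      then have "C \<subset> H" by auto
      then show "?\<mu> C = (-1) ^ card C"
        using psubset_card_mono[OF finH, of C] less.prems by (intro less.hyps) auto
    qed
    also have "\<dots> = (\<Sum>C\<in>Pow H. (-1) ^ card C) - (-1) ^ card H"
      using finH by (simp add: sum_diff1)
    also have "(\<Sum>C\<in>Pow H. (-1) ^ card C) = (0 :: int)"
      using sum_Pow_by_card[OF finH, of "\<lambda>k. (-1 :: int) ^ k"] False finH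
        choose_alternating_sum[of "card H", where 'a = int]
      by (simp add: mult.commute card_gt_0_iff)
    finally show ?thesis by simp
  qed simp
qed

lemma char_polynomial_restriction_uniform:
  assumes "finite E" "0 < d" "F \<subseteq> E" "card F < d"
  shows "char_polynomial (restriction (uniform_matroid E d) F) = [:-1, 1:] ^ card F"
proof -
  interpret loopless_matroid "uniform_matroid E d" by (rule loopless_uniform[OF assms(1,2)])
  have finF: "finite F" using assms finite_subset by blast
  have card_le: "card H \<le> card F" if "H \<subseteq> F" for H using card_mono[OF finF that] .
  have F: "F \<in> flats (uniform_matroid E d)" using assms by (simp add: flats_uniform)
  have sets: "{H. H \<in> flats (uniform_matroid E d) \<and> H \<subseteq> F} = Pow F"
  proof -
    have "H \<in> insert E {F. F \<subseteq> E \<and> card F < d}" if "H \<subseteq> F" for H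
      using assms card_le[OF that] that by auto
    then show ?thesis unfolding flats_uniform[OF assms(1)] by blast
  qed
  have "char_polynomial (restriction (uniform_matroid E d) F) =
      (\<Sum>H\<in>Pow F. monom ((-1) ^ card H) (card F - card H))"
    unfolding char_polynomial_restriction[OF F] sets
  proof (intro sum.cong refl)
    fix H assume "H \<in> Pow F"
    then have "H \<subseteq> E" "card H < d" "card H \<le> card F"
      using assms card_le[of H] by auto
    then show "monom (mobius (flats (uniform_matroid E d)) {} H)
        (mrank (uniform_matroid E d) F - mrank (uniform_matroid E d) H) =
        monom ((-1) ^ card H) (card F - card H)"
      using assms by (simp add: mobius_flats_uniform mrank_uniform)
  qed
  also have "\<dots> = (\<Sum>k\<le>card F. of_nat (card F choose k) * monom ((-1) ^ k) (card F - k))"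
    using finF by (rule sum_Pow_by_card)
  also have "\<dots> = (\<Sum>k\<le>card F. of_nat (card F choose k) * [:-1:] ^ k * [:0, 1:] ^ (card F - k))"
    by (intro sum.cong refl) (simp add: monom_altdef poly_const_pow mult.assoc)
  also have "\<dots> = ([:-1:] + [:0, 1:]) ^ card F" by (rule binomial_ring[symmetric])
  finally show ?thesis by simp
qed

text \<open>Only flats with \<open>i\<close> elements reach degree \<open>d - i\<close>. The flat
  \<open>E\<close> has rank \<open>d\<close> and contributes only to the constant term, which
  \<open>i < d\<close> excludes.\<close>

lemma coeff_char_polynomial_uniform:
  assumes "finite E" "0 < d" "d < card E" "i < d"
  shows "coeff (char_polynomial (uniform_matroid E d)) (d - i) = (-1) ^ i * int (card E choose i)"
proof -
  have ground: "ground (uniform_matroid E d) = E" by (simp add: uniform_matroid_def)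
  let ?S = "{F. F \<subseteq> E \<and> card F < d}"
  have S: "finite ?S" "E \<notin> ?S" using assms by auto
  have "coeff (char_polynomial (uniform_matroid E d)) (d - i) =
      (\<Sum>F\<in>?S. coeff (monom (mobius (flats (uniform_matroid E d)) {} F)
        (d - mrank (uniform_matroid E d) F)) (d - i))"
    unfolding char_polynomial_def ground
    using S assms by (simp add: flats_uniform[OF assms(1)] coeff_sum mrank_uniform)
  also have "\<dots> = (\<Sum>F\<in>?S. if card F = i then (-1) ^ card F else 0)"
    using assms by (intro sum.cong refl) (auto simp: mrank_uniform mobius_flats_uniform)
  also have "\<dots> = (\<Sum>k<d. of_nat (card E choose k) * (if k = i then (-1) ^ k else 0))"
    by (rule sum_subsets_by_card[OF assms(1)])
  also have "\<dots> = (\<Sum>k<d. if k = i then int (card E choose k) * (-1) ^ k else 0)"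
    by (intro sum.cong) auto
  also have "\<dots> = (-1) ^ i * int (card E choose i)"
    using assms(4) by (simp add: sum.delta)
  finally show ?thesis .
qed

section \<open>The Kazhdan-Lusztig coefficients\<close>

text \<open>Contracting a flat of size \<open>k < d\<close> lowers the rank to \<open>d - k\<close>
  and keeps \<open>m\<close>, so strong induction on \<open>d\<close> with \<open>m\<close> fixed
  suffices. Coefficients of degree \<open>d - i\<close> are compared in the defining
  equation.\<close>

lemma coeff_kl_poly_uniform:
  assumes "m > 0" "d > 0" "finite E" "card E = m + d"
  shows "real_of_int (coeff (kl_poly (uniform_matroid E d)) i) =
    (if 2 * i < d then uniform_kl_coeff m d i else 0)"
  using assms(2-4)
proof (induction d arbitrary: E i rule: less_induct)
  case (less d)
  let ?U = "uniform_matroid E d"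
  interpret loopless_matroid ?U by (rule loopless_uniform[OF less.prems(2,1)])
  have ll: "loopless_matroid ?U" by (rule loopless_uniform[OF less.prems(2,1)])
  have ground: "ground ?U = E" by (simp add: uniform_matroid_def)
  have rk: "rk ?U = d" using less.prems by (intro rk_uniform) auto
  have deg: "2 * degree (kl_poly ?U) < d"
    using kl_assignment_kl_poly ll rk less.prems(1) unfolding kl_assignment_def by metis
  have eqn: "recip_poly d (kl_poly ?U) =
      (\<Sum>F\<in>flats ?U. char_polynomial (restriction ?U F) * kl_poly (contraction ?U F))"
    using kl_assignment_kl_poly ll rk unfolding kl_assignment_def by metis
  show ?case
  proof (cases "2 * i < d")
    case False
    then show ?thesis using deg by (simp add: coeff_eq_0)
  next
    case True
    let ?S = "{F. F \<subseteq> E \<and> card F < d}"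
    have S: "finite ?S" "E \<notin> ?S" using less.prems by auto
    \<comment> \<open>\<open>contraction_uniform\<close> does not cover \<open>E\<close>, which has
      more than \<open>d\<close> elements; rank 0 decides this case.\<close>
    have top: "kl_poly (contraction ?U E) = 1"
    proof -
      have "E \<in> flats ?U" using ground_in_flats ground by simp
      then have "loopless_matroid (contraction ?U E)" by (rule loopless_contraction)
      moreover have "rk (contraction ?U E) = 0"
        using rk_contraction[OF \<open>E \<in> flats ?U\<close>] ground by simp
      ultimately show ?thesis using kl_assignment_kl_poly unfolding kl_assignment_def by metis
    qed
    define s where "s k = (\<Sum>j\<le>d - i. (if 2 * j < d - k then uniform_kl_coeff m (d - k) j else 0) *
        (if d - i - j \<le> k then real (k choose (d - i - j)) * (-1) ^ (k - (d - i - j)) else 0))" for k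
    \<comment> \<open>The empty flat contributes \<open>kl_poly ?U\<close> itself, whose degree is
      below \<open>d - i\<close>; hence the value 0 at \<open>k = 0\<close>.\<close>
    define r where "r k = (if k = 0 then 0 else s k)" for k
    have flat: "real_of_int (coeff (char_polynomial (restriction ?U F) * kl_poly (contraction ?U F)) (d - i)) =
        r (card F)" if "F \<in> ?S" for F
    proof -
      have F: "F \<subseteq> E" "card F < d" using that by auto
      have finF: "finite F" using F less.prems finite_subset by blast
      show ?thesis
      proof (cases "F = {}")
        case True
        have "degree (kl_poly ?U) < d - i" using deg \<open>2 * i < d\<close> by linarith
        then show ?thesis
          using True by (simp add: r_def char_polynomial_restriction_empty contraction_empty coeff_eq_0)
      next
        case False
        define k where "k = card F"
        have k: "0 < k" "k < d" using False finF F by (auto simp: k_def card_gt_0_iff)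
        have IH: "real_of_int (coeff (kl_poly (contraction ?U F)) j) =
            (if 2 * j < d - k then uniform_kl_coeff m (d - k) j else 0)" for j
        proof -
          have "card (E - F) = m + (d - k)"
            using F finF less.prems k by (simp add: card_Diff_subset k_def)
          then show ?thesis
            using less.IH[of "d - k" "E - F" j] k less.prems F
            by (simp add: contraction_uniform k_def)
        qed
        have lin: "real_of_int (coeff ([:-1, 1:] ^ k) l) =
            (if l \<le> k then real (k choose l) * (-1) ^ (k - l) else 0)" for l
        proof (cases "l \<le> k")
          case False
          then show ?thesis by (simp add: coeff_eq_0 degree_linear_power)
        qed (simp add: coeff_linear_poly_power)
        \<comment> \<open>The factors are swapped so that \<open>coeff_mult\<close> sums over the
          degree \<open>j\<close> in the Kazhdan-Lusztig factor, as in \<open>s\<close>.\<close>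
        have "char_polynomial (restriction ?U F) * kl_poly (contraction ?U F) =
            kl_poly (contraction ?U F) * [:-1, 1:] ^ k"
          unfolding char_polynomial_restriction_uniform[OF less.prems(2,1) F] k_def
          by (rule mult.commute)
        then have "real_of_int (coeff (char_polynomial (restriction ?U F) *
            kl_poly (contraction ?U F)) (d - i)) = s k"
          by (simp only: coeff_mult of_int_sum of_int_mult IH lin s_def)
        then show ?thesis using k(1) by (simp add: r_def flip: k_def)
      qed
    qed
    have "coeff (kl_poly ?U) i = coeff (recip_poly d (kl_poly ?U)) (d - i)"
      using deg True by (subst coeff_recip_poly) auto
    also have "\<dots> = coeff (char_polynomial ?U) (d - i) +
        (\<Sum>F\<in>?S. coeff (char_polynomial (restriction ?U F) * kl_poly (contraction ?U F)) (d - i))"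
      unfolding eqn flats_uniform[OF less.prems(2)] using S top restriction_ground
      by (simp add: coeff_sum ground)
    finally have "real_of_int (coeff (kl_poly ?U) i) = (-1) ^ i * real ((m + d) choose i) +
        (\<Sum>F\<in>?S. r (card F))"
      using flat True less.prems assms(1)
      by (simp add: coeff_char_polynomial_uniform)
    also have "(\<Sum>F\<in>?S. r (card F)) = (\<Sum>k<d. real ((m + d) choose k) * r k)"
      using sum_subsets_by_card[OF less.prems(2), where d = d and g = r] less.prems(3) by simp
    also have "\<dots> = (\<Sum>k=1..<d. real ((m + d) choose k) * s k)"
      by (intro sum.mono_neutral_cong_right) (auto simp: r_def)
    finally show ?thesis
      using uniform_kl_coeff_recursion[OF assms(1) True] True by (simp add: s_def)
  qed
qed

theorem theorem1p4:
  fixes m d :: nat and E :: "'a set"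
  assumes "m > 0" and "d > 0" and "finite E" and "card E = m + d"
  shows "degree (kl_poly (uniform_matroid E d)) \<le> (d - 1) div 2 \<and>
    (\<forall>i \<le> (d - 1) div 2.
      real_of_int (coeff (kl_poly (uniform_matroid E d)) i) =
        1 / (real d - real i) * ((real d + real m) gchoose i) *
        (\<Sum>h = 0..m - 1. ((real d - real i + real h) gchoose (h + i + 1)) *
                          ((real i - 1 + real h) gchoose h)))"
proof (intro conjI allI impI)
  show "degree (kl_poly (uniform_matroid E d)) \<le> (d - 1) div 2"
  proof (intro degree_le allI impI)
    fix i assume "(d - 1) div 2 < i"
    then have "\<not> 2 * i < d" by linarith
    then show "coeff (kl_poly (uniform_matroid E d)) i = 0"
      using coeff_kl_poly_uniform[OF assms, of i] by simp
  qed
next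
  fix i assume "i \<le> (d - 1) div 2"
  then have i: "2 * i < d" using assms by linarith
  let ?sum = "\<Sum>h = 0..m - 1. ((real d - real i + real h) gchoose (h + i + 1)) *
                          ((real i - 1 + real h) gchoose h)"
  \<comment> \<open>Positivity of \<open>m\<close> matters: for \<open>m = 0\<close> the left range
    would be \<open>{0}\<close>.\<close>
  have "{0..m - 1} = {..<m}" using assms(1) by auto
  then have "(real d - real i) * poly (interp_poly m i) (real d - real i) = ?sum"
    by (simp only: times_poly_interp_poly)
  moreover have "real d - real i \<noteq> 0" using i by auto
  ultimately have "poly (interp_poly m i) (real d - real i) = 1 / (real d - real i) * ?sum"
    by (simp add: field_simps)
  moreover have "real ((m + d) choose i) = (real d + real m) gchoose i"
    by (simp add: binomial_gbinomial add.commute)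
  ultimately show "real_of_int (coeff (kl_poly (uniform_matroid E d)) i) =
      1 / (real d - real i) * ((real d + real m) gchoose i) * ?sum"
    using coeff_kl_poly_uniform[OF assms, of i] i
    by (simp add: uniform_kl_coeff_def of_nat_diff)
qed

end
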